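(* For every integer $n\ge 0$: (i) $b_{3,5,8}\big(16(5n+j)+3\big)\equiv 0\pmod 2$ for $j\in\{2,4\}$. (ii) $b_{3,5,8}\big(80(5n+j)+51\big)\equiv 0\pmod 2$ for $j\in\{2,4\}$. (iii) $b_{3,5,8}\big(400(5n+j)+291\big)\equiv 0\pmod 2$ for $j\in\{1,3\}$. (iv) $b_{3,5,8}(2000n+1091)\equiv b_{3,5,8}(80n+51)\pmod 2$.
   Context: For $|q|<1$ and a positive integer $i$, $f_i := (q^i;q^i)_\infty = \prod_{m=1}^{\infty}(1-q^{im})$. The integers $b_{3,5,8}(n)$, $n\ge 0$, are defined by the generating function $$\sum_{n=0}^{\infty} b_{3,5,8}(n)q^n = \frac{f_3f_5f_8}{f_1f_{15}f_{24}f_{40}f_{120}} ,$$ which is the case $(\ell,k,r)=(3,5,8)$ of $\sum_{n\ge 0} b_{\ell,k,r}(n)q^n=\dfrac{f_\ell f_kf_r}{f_1f_{\ell k}f_{\ell r}f_{kr}f_{\ell kr}}$. *)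

theory Defs
  imports "HOL-Complex_Analysis.Complex_Analysis" "HOL-Number_Theory.Cong"
begin

definition euler_f :: "nat \<Rightarrow> complex \<Rightarrow> complex" where
  "euler_f i q = (\<Prod>m. 1 - q ^ (i * Suc m))"

definition b_gen_fun :: "nat \<Rightarrow> nat \<Rightarrow> nat \<Rightarrow> complex \<Rightarrow> complex" where
  "b_gen_fun l k r q =
     euler_f l q * euler_f k q * euler_f r q /
     (euler_f 1 q * euler_f (l * k) q * euler_f (l * r) q * euler_f (k * r) q * euler_f (l * k * r) q)"

text \<open>For positive \<open>l\<close>, \<open>k\<close>, \<open>r\<close> there is exactly one such integer sequence
  (\<open>b_coeff_ex1\<close>), so the definite description denotes it (\<open>b_coeff_sums\<close>).\<close>

definition b_coeff :: "nat \<Rightarrow> nat \<Rightarrow> nat \<Rightarrow> nat \<Rightarrow> int" where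
  "b_coeff l k r = (THE c. \<forall>q::complex. norm q < 1 \<longrightarrow>
     (\<lambda>n. of_int (c n) * q ^ n) sums b_gen_fun l k r q)"

text \<open>The remainder of the theory proves existence and uniqueness.\<close>

definition int_coeffs :: "(complex \<Rightarrow> complex) \<Rightarrow> bool" where
  "int_coeffs g \<longleftrightarrow> g holomorphic_on ball 0 1 \<and> (\<forall>n. fps_nth (fps_expansion g 0) n \<in> \<int>)"

lemma holomorphic_has_fps_expansion:
  assumes "g holomorphic_on ball 0 (1::real)"
  shows "g has_fps_expansion fps_expansion g (0::complex)"
proof -
  have "g analytic_on {0}"
    using assms by (auto simp: analytic_at intro!: exI[of _ "ball 0 1"])
  thus ?thesis by (simp add: analytic_at_imp_has_fps_expansion_0)
qed

lemma int_coeffs_mult: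
  assumes "int_coeffs g" "int_coeffs h"
  shows "int_coeffs (\<lambda>q. g q * h q)"
proof -
  have "(\<lambda>q. g q * h q) has_fps_expansion fps_expansion g 0 * fps_expansion h 0"
    using assms by (intro has_fps_expansion_mult holomorphic_has_fps_expansion) (auto simp: int_coeffs_def)
  hence "fps_expansion (\<lambda>q. g q * h q) 0 = fps_expansion g 0 * fps_expansion h 0"
    by (rule fps_expansion_eqI)
  thus ?thesis using assms
    by (auto simp: int_coeffs_def fps_mult_nth intro!: holomorphic_intros Ints_sum Ints_mult)
qed

lemma int_coeffs_one_minus_power: "int_coeffs (\<lambda>q. 1 - q ^ k)"
proof -
  have "(\<lambda>q::complex. 1 - q ^ k) has_fps_expansion 1 - fps_X ^ k"
    by (intro fps_expansion_intros)
  hence "fps_expansion (\<lambda>q::complex. 1 - q ^ k) 0 = 1 - fps_X ^ k"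
    by (rule fps_expansion_eqI)
  thus ?thesis
    by (auto simp: int_coeffs_def fps_one_nth intro!: holomorphic_intros)
qed

lemma int_coeffs_prod:
  "int_coeffs (\<lambda>q. \<Prod>m<M. 1 - q ^ (i * Suc m))"
proof (induction M)
  case 0
  have "fps_expansion (\<lambda>_::complex. 1) 0 = 1"
    by (rule fps_expansion_eqI) (rule fps_expansion_intros)
  thus ?case by (auto simp: int_coeffs_def fps_one_nth)
next
  case (Suc M)
  thus ?case using int_coeffs_mult[OF Suc int_coeffs_one_minus_power] by simp
qed

lemma int_coeffs_inverse:
  assumes g: "int_coeffs g" and nz: "\<And>q. norm q < 1 \<Longrightarrow> g q \<noteq> 0" and g0: "g 0 = 1"
  shows "int_coeffs (\<lambda>q. inverse (g q))"
proof -
  let ?h = "\<lambda>q. inverse (g q)"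
  let ?G = "fps_expansion g 0" and ?H = "fps_expansion ?h 0"
  have hol: "?h holomorphic_on ball 0 1"
    using g nz by (auto simp: int_coeffs_def intro!: holomorphic_intros)
  have "(\<lambda>q. g q * ?h q) has_fps_expansion ?G * ?H"
    using g hol by (intro has_fps_expansion_mult holomorphic_has_fps_expansion) (auto simp: int_coeffs_def)
  moreover have ev: "eventually (\<lambda>q. g q * ?h q = 1) (nhds 0)"
    using eventually_nhds_in_open[of "ball 0 1" "0::complex"] nz
    by (auto elim!: eventually_mono)
  ultimately have "(\<lambda>_. 1) has_fps_expansion ?G * ?H"
    using has_fps_expansion_cong[OF ev refl] by blast
  moreover have "(\<lambda>_. 1) has_fps_expansion (1 :: complex fps)"
    by (rule fps_expansion_intros)
  ultimately have GH: "?G * ?H = 1"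
    by (rule fps_expansion_unique_complex)
  have G0: "fps_nth ?G 0 = 1"
    using g0 by (simp add: fps_expansion_def)
  have "fps_nth ?H n \<in> \<int>" for n
  proof (induction n rule: less_induct)
    case (less n)
    have "fps_nth (?G * ?H) n = (\<Sum>j=0..n. fps_nth ?G j * fps_nth ?H (n - j))"
      by (simp add: fps_mult_nth)
    also have "\<dots> = fps_nth ?H n + (\<Sum>j=1..n. fps_nth ?G j * fps_nth ?H (n - j))"
      using G0 by (simp add: sum.atLeast_Suc_atMost)
    finally have "fps_nth ?H n = fps_nth 1 n - (\<Sum>j=1..n. fps_nth ?G j * fps_nth ?H (n - j))"
      using GH by (simp add: algebra_simps)
    moreover have "(\<Sum>j=1..n. fps_nth ?G j * fps_nth ?H (n - j)) \<in> \<int>"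
      using g less by (intro Ints_sum Ints_mult) (auto simp: int_coeffs_def)
    moreover have "fps_nth (1 :: complex fps) n \<in> \<int>"
      by (simp add: fps_one_nth)
    ultimately show ?case by (metis Ints_diff)
  qed
  thus ?thesis using hol by (simp add: int_coeffs_def)
qed

lemma summable_euler:
  assumes "i > 0" "norm (q::complex) < 1"
  shows "summable (\<lambda>m. norm (q ^ (i * Suc m)))"
proof (rule summable_comparison_test')
  show "summable (\<lambda>m. norm q ^ m)"
    using assms by (intro summable_geometric) auto
  show "norm (norm (q ^ (i * Suc m))) \<le> norm q ^ m" for m
  proof -
    have "m \<le> i * Suc m" using assms(1) by (cases i) auto
    thus ?thesis using assms(2) by (auto simp: norm_power intro!: power_decreasing)
  qed
qed

lemma euler_factor_nonzero:
  assumes "i > 0" "norm (q::complex) < 1"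
  shows "1 - q ^ (i * Suc m) \<noteq> 0"
proof
  assume "1 - q ^ (i * Suc m) = 0"
  hence "norm q ^ (i * Suc m) = 1" by (metis eq_iff_diff_eq_0 norm_one norm_power)
  moreover have "norm q ^ (i * Suc m) < 1"
    using assms by (intro power_less_one_iff[THEN iffD2]) auto
  ultimately show False by simp
qed

lemma convergent_prod_euler:
  assumes "i > 0" "norm (q::complex) < 1"
  shows "convergent_prod (\<lambda>m. 1 - q ^ (i * Suc m))"
proof -
  have "summable (\<lambda>m. norm ((1 - q ^ (i * Suc m)) - 1))"
    using summable_euler[OF assms] by simp
  thus ?thesis
    by (intro abs_convergent_prod_imp_convergent_prod summable_imp_abs_convergent_prod)
qed

lemma euler_f_nonzero:
  assumes "i > 0" "norm q < 1"
  shows "euler_f i q \<noteq> 0"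
  unfolding euler_f_def
  using prodinf_nonzero[OF convergent_prod_euler[OF assms]] euler_factor_nonzero[OF assms] by blast

lemma euler_f_0: "i > 0 \<Longrightarrow> euler_f i 0 = 1"
  by (simp add: euler_f_def power_0_left)

lemma uniform_limit_euler_f:
  assumes i: "i > 0" and r: "r < 1"
  shows "uniform_limit (cball 0 r) (\<lambda>M q. \<Prod>m<M. 1 - q ^ (i * Suc m)) (euler_f i) sequentially"
proof (cases "r < 0")
  case True
  thus ?thesis by (simp add: uniform_limit_iff)
next
  case False
  have "uniformly_convergent_on (cball 0 r) (\<lambda>N q::complex. \<Sum>n<N. norm ((1 - q ^ (i * Suc n)) - 1))"
  proof (rule Weierstrass_m_test')
    show "summable (\<lambda>n. r ^ n)" using False r by (intro summable_geometric) auto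
    fix n and q :: complex
    assume q: "q \<in> cball 0 r"
    have "n \<le> i * Suc n" using i by (cases i) auto
    hence "norm q ^ (i * Suc n) \<le> norm q ^ n"
      using q r by (intro power_decreasing) auto
    also have "\<dots> \<le> r ^ n" using q by (intro power_mono) auto
    finally show "norm (norm ((1 - q ^ (i * Suc n)) - 1)) \<le> r ^ n"
      by (simp add: norm_power)
  qed
  hence "uniformly_convergent_on (cball 0 r) (\<lambda>N q::complex. \<Prod>n<N. 1 - q ^ (i * Suc n))"
    by (intro Infinite_Products.uniformly_convergent_on_prod') (auto intro!: continuous_intros)
  hence ul: "uniform_limit (cball 0 r) (\<lambda>N q::complex. \<Prod>n<N. 1 - q ^ (i * Suc n))
               (\<lambda>q. lim (\<lambda>N. \<Prod>n<N. 1 - q ^ (i * Suc n))) sequentially"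
    using uniformly_convergent_uniform_limit_iff by blast
  have "euler_f i q = lim (\<lambda>N. \<Prod>n<N. 1 - q ^ (i * Suc n))" if "q \<in> cball 0 r" for q
  proof -
    have "norm q < 1" using that r by auto
    thus ?thesis unfolding euler_f_def
      using prodinf_eq_lim'[OF convergent_prod_euler[OF i] euler_factor_nonzero[OF i]] by blast
  qed
  with ul show ?thesis
    by (metis (mono_tags, lifting) uniform_limit_cong')
qed

lemma int_coeffs_euler_f:
  assumes i: "i > 0"
  shows "int_coeffs (euler_f i)"
proof -
  let ?P = "\<lambda>M q. \<Prod>m<M. 1 - (q::complex) ^ (i * Suc m)"
  have hol: "euler_f i holomorphic_on ball 0 1"
  proof (rule holomorphic_uniform_sequence)
    show "?P M holomorphic_on ball 0 1" for M
      by (intro holomorphic_intros)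
    fix x :: complex assume x: "x \<in> ball 0 1"
    define d where "d = (1 - norm x) / 2"
    have d: "d > 0" "norm x + d < 1" using x by (auto simp: d_def field_simps)
    have sub: "cball x d \<subseteq> cball 0 (norm x + d)"
    proof
      fix y assume "y \<in> cball x d"
      hence "norm (y - x) \<le> d" by (simp add: dist_norm norm_minus_commute)
      thus "y \<in> cball 0 (norm x + d)" using norm_triangle_sub[of y x] by simp
    qed
    show "\<exists>d>0. cball x d \<subseteq> ball 0 1 \<and> uniform_limit (cball x d) ?P (euler_f i) sequentially"
    proof (intro exI[of _ d] conjI)
      show "cball x d \<subseteq> ball 0 1" using sub d by auto
      show "uniform_limit (cball x d) ?P (euler_f i) sequentially"
        by (rule uniform_limit_on_subset[OF uniform_limit_euler_f[OF i d(2)] sub])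
    qed (use d in auto)
  qed auto
  have "fps_nth (fps_expansion (euler_f i) 0) n \<in> \<int>" for n
  proof -
    have "uniform_limit (ball 0 (1/2)) ?P (euler_f i) sequentially"
      by (rule uniform_limit_on_subset[OF uniform_limit_euler_f[OF i, of "1/2"]]) auto
    hence "(\<lambda>M. (deriv ^^ n) (?P M) 0) \<longlonglongrightarrow> (deriv ^^ n) (euler_f i) 0"
      by (rule higher_deriv_complex_uniform_limit)
         (auto intro!: always_eventually holomorphic_intros)
    hence "(\<lambda>M. (deriv ^^ n) (?P M) 0 / fact n) \<longlonglongrightarrow> (deriv ^^ n) (euler_f i) 0 / fact n"
      by (intro tendsto_intros) auto
    hence "(\<lambda>M. fps_nth (fps_expansion (?P M) 0) n) \<longlonglongrightarrow> fps_nth (fps_expansion (euler_f i) 0) n"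
      by (simp add: fps_expansion_def)
    moreover have "fps_nth (fps_expansion (?P M) 0) n \<in> \<int>" for M
      using int_coeffs_prod[of i M] by (simp add: int_coeffs_def)
    ultimately show ?thesis
      by (intro Lim_in_closed_set[OF closed_Ints _ sequentially_bot]) auto
  qed
  with hol show ?thesis by (simp add: int_coeffs_def)
qed

lemma int_coeffs_b_gen_fun:
  assumes "l > 0" "k > 0" "r > 0"
  shows "int_coeffs (b_gen_fun l k r)"
proof -
  have inv: "int_coeffs (\<lambda>q. inverse (euler_f i q))" if "i > 0" for i
    using that by (intro int_coeffs_inverse int_coeffs_euler_f euler_f_nonzero euler_f_0)
  have eq: "b_gen_fun l k r = (\<lambda>q. euler_f l q * euler_f k q * euler_f r q *
     (inverse (euler_f 1 q) * inverse (euler_f (l * k) q) * inverse (euler_f (l * r) q) *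
      inverse (euler_f (k * r) q) * inverse (euler_f (l * k * r) q)))"
    by (simp add: b_gen_fun_def fun_eq_iff divide_inverse)
  show ?thesis
    unfolding eq using assms by (intro int_coeffs_mult inv int_coeffs_euler_f) auto
qed

lemma b_coeff_ex1:
  assumes "l > 0" "k > 0" "r > 0"
  shows "\<exists>!c::nat \<Rightarrow> int. \<forall>q::complex. norm q < 1 \<longrightarrow>
           (\<lambda>n. of_int (c n) * q ^ n) sums b_gen_fun l k r q"
proof -
  let ?g = "b_gen_fun l k r"
  let ?G = "fps_expansion ?g 0"
  have g: "?g holomorphic_on ball 0 1" and "\<forall>n. \<exists>z. fps_nth ?G n = of_int z"
    using int_coeffs_b_gen_fun[OF assms] by (auto simp: int_coeffs_def elim!: Ints_cases)
  then obtain c where c: "\<And>n. fps_nth ?G n = of_int (c n)" by metis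
  show ?thesis
  proof (rule ex1I[of _ c], intro allI impI)
    fix q :: complex assume "norm q < 1"
    hence "(\<lambda>n. (deriv ^^ n) ?g 0 / fact n * (q - 0) ^ n) sums ?g q"
      by (intro holomorphic_power_series[OF g]) auto
    thus "(\<lambda>n. of_int (c n) * q ^ n) sums ?g q"
      by (simp add: c[symmetric] fps_expansion_def)
  next
    fix d :: "nat \<Rightarrow> int"
    assume d: "\<forall>q::complex. norm q < 1 \<longrightarrow> (\<lambda>n. of_int (d n) * q ^ n) sums ?g q"
    define D where "D = Abs_fps (\<lambda>n. complex_of_int (d n))"
    have "fps_conv_radius D \<ge> 1"
      unfolding fps_conv_radius_def
    proof (rule conv_radius_geI_ex)
      fix \<rho> :: real assume "0 < \<rho>" "ereal \<rho> < 1"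
      hence \<rho>: "norm (complex_of_real \<rho>) = \<rho>" "\<rho> < 1" by auto
      hence "summable (\<lambda>n. of_int (d n) * complex_of_real \<rho> ^ n)"
        using d sums_summable by metis
      with \<rho> show "\<exists>z. norm z = \<rho> \<and> summable (\<lambda>n. fps_nth D n * z ^ n)"
        by (intro exI[of _ "complex_of_real \<rho>"]) (simp add: D_def)
    qed
    hence "fps_conv_radius D > 0" by (rule less_le_trans[rotated]) auto
    moreover have "eventually (\<lambda>q. q \<in> ball 0 1) (nhds (0::complex))"
      by (intro eventually_nhds_in_open) auto
    hence "eventually (\<lambda>q. eval_fps D q = ?g q) (nhds 0)"
      by eventually_elim (use d in \<open>auto simp: eval_fps_def D_def dest!: sums_unique[symmetric]\<close>)
    ultimately have "?g has_fps_expansion D" by (simp add: has_fps_expansion_def)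
    hence "?G = D" by (rule fps_expansion_eqI)
    thus "d = c" using c by (auto simp: D_def fun_eq_iff)
  qed
qed

lemma b_coeff_sums:
  assumes "l > 0" "k > 0" "r > 0" and "norm (q::complex) < 1"
  shows "(\<lambda>n. of_int (b_coeff l k r n) * q ^ n) sums b_gen_fun l k r q"
  using theI'[OF b_coeff_ex1[OF assms(1-3)]] assms(4) unfolding b_coeff_def by blast

end

theory Submission
  imports Defs "HOL-Library.Z2"
begin

text \<open>
  All series are reduced modulo \<open>2\<close>, where squaring replaces \<open>q\<close> by \<open>q\<^sup>2\<close>, so that
  \<open>f\<^sub>2\<^sub>i = f\<^sub>i\<^sup>2\<close>. Write \<open>a, b, c, d\<close> for \<open>f\<^sub>1, f\<^sub>3, f\<^sub>5, f\<^sub>1\<^sub>5\<close>. By the pentagonal number theorem, products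
  of these series count representations by binary quadratic forms, and reflections
  of the forms \<open>x\<^sup>2 + 3y\<^sup>2\<close> and \<open>x\<^sup>2 + 5y\<^sup>2\<close> leave only their fixed points modulo \<open>2\<close>. This gives
  \<open>ac = a\<^sup>6 + qc\<^sup>6\<close> and \<open>a\<^sup>3b\<^sup>3 = a\<^sup>1\<^sup>2 + qb\<^sup>1\<^sup>2\<close>. Comparing odd parts of \<open>E = abcd\<close> and of \<open>E\<^sup>3\<close> then shows
  that the odd part of \<open>E\<close> is \<open>E\<close> itself (the Hecke relation at \<open>2\<close>, modulo \<open>2\<close>, for
  the newform \<open>qE\<close> of level \<open>15\<close>). This determines the successive 2-dissections of the generating function and
  yields \<open>\<Sum> b(16n + 3) q\<^sup>n = q f\<^sub>2 f\<^sub>1\<^sub>5\<close>. So \<open>b(16n + 3)\<close> has the parity of the number of representations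
  of \<open>24n - 7\<close> by \<open>2x\<^sup>2 + 15y\<^sup>2\<close> with \<open>x, y\<close> congruent to \<open>1\<close> modulo \<open>6\<close>, and the claims follow by
  considering this form and \<open>10x\<^sup>2 + 3y\<^sup>2\<close> modulo \<open>5\<close>.
\<close>

unbundle no vec_syntax

section \<open>Theta series over the field with two elements\<close>

lemma of_nat_card_involution_bit:
  assumes "\<And>v. v \<in> A \<Longrightarrow> h v \<in> A" "\<And>v. v \<in> A \<Longrightarrow> h (h v) = v" "\<And>v. v \<in> A \<Longrightarrow> h v \<noteq> v"
  shows "(of_nat (card A) :: bit) = 0"
proof -
  have "(\<Sum>v\<in>A. 1::bit) = 0"
    by (rule sum_involution_eq_0[of A _ h]) (use assms in auto)
  thus ?thesis by simp
qed

lemma of_nat_bit: "(of_nat n :: bit) = of_bool (odd n)"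
  by (induction n) auto

lemma of_int_bit_eq_0_iff: "(of_int k :: bit) = 0 \<longleftrightarrow> even k"
proof (cases k rule: int_cases2)
  case (nonneg n)
  thus ?thesis by (simp add: of_nat_bit del: of_nat_eq_0_iff)
next
  case (nonpos n)
  thus ?thesis by (simp add: of_nat_bit del: of_nat_eq_0_iff)
qed

definition theta :: "'a set \<Rightarrow> ('a \<Rightarrow> int) \<Rightarrow> bit fps" where
  "theta S w = Abs_fps (\<lambda>n. of_nat (card {v \<in> S. w v = int n}))"

lemma theta_nth: "theta S w $ n = of_nat (card {v \<in> S. w v = int n})"
  by (simp add: theta_def)

lemma theta_mult:
  assumes "\<And>n. finite {x \<in> S. w x = int n}" "\<And>n. finite {y \<in> T. u y = int n}"
    and "\<And>x. x \<in> S \<Longrightarrow> w x \<ge> 0" "\<And>y. y \<in> T \<Longrightarrow> u y \<ge> 0"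
  shows "theta S w * theta T u = theta (S \<times> T) (\<lambda>(x, y). w x + u y)"
proof (rule fps_ext)
  fix n
  let ?A = "\<lambda>i. {x \<in> S. w x = int i} \<times> {y \<in> T. u y = int (n - i)}"
  have "{v \<in> S \<times> T. (case v of (x, y) \<Rightarrow> w x + u y) = int n} = (\<Union>i\<in>{0..n}. ?A i)"
  proof (intro equalityI subsetI)
    fix v assume "v \<in> {v \<in> S \<times> T. (case v of (x, y) \<Rightarrow> w x + u y) = int n}"
    then obtain x y where v: "v = (x, y)" "x \<in> S" "y \<in> T" "w x + u y = int n" by auto
    thus "v \<in> (\<Union>i\<in>{0..n}. ?A i)"
      using assms(3)[of x] assms(4)[of y] by (auto intro!: bexI[of _ "nat (w x)"])
  qed auto
  moreover have "card (\<Union>i\<in>{0..n}. ?A i) = (\<Sum>i=0..n. card (?A i))"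
    by (rule card_UN_disjoint)
       (use assms(1,2) in \<open>auto intro!: finite_cartesian_product simp del: of_nat_diff\<close>)
  ultimately show "(theta S w * theta T u) $ n = theta (S \<times> T) (\<lambda>(x, y). w x + u y) $ n"
    by (simp add: theta_nth fps_mult_nth card_cartesian_product)
qed

lemma theta_compose:
  assumes "t > 0"
  shows "theta S w oo fps_X ^ t = theta S (\<lambda>v. int t * w v)"
proof (rule fps_ext)
  fix n
  have "{v \<in> S. int t * w v = int n} = (if t dvd n then {v \<in> S. w v = int (n div t)} else {})"
    using assms by (auto simp: zdiv_int) (metis dvd_triv_left int_dvd_int_iff)+
  thus "(theta S w oo fps_X ^ t) $ n = theta S (\<lambda>v. int t * w v) $ n"
    by (simp add: theta_nth fps_nth_compose_X_power)
qed

text \<open>An element of the half-system \<open>H\<close> stands for the pair \<open>{v, -v}\<close>, so that \<open>\<rho>\<close> still acts when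
  it leaves \<open>H\<close>.\<close>

lemma card_half_system_reflection:
  fixes \<rho> :: "'a::group_add \<Rightarrow> 'a"
  assumes "finite H"
    and "\<And>v. v \<in> H \<Longrightarrow> - v \<notin> H" "\<And>v. v \<in> H \<Longrightarrow> \<rho> v \<in> H \<or> - \<rho> v \<in> H"
    and "\<And>v. v \<in> H \<Longrightarrow> \<rho> (\<rho> v) = v" "\<And>v. v \<in> H \<Longrightarrow> \<rho> (- \<rho> v) = - v"
  shows "(of_nat (card H) :: bit) = of_nat (card {v \<in> H. \<rho> v = v}) + of_nat (card {v \<in> H. \<rho> v = - v})"
proof -
  define h where "h v = (if \<rho> v \<in> H then \<rho> v else - \<rho> v)" for v
  let ?M = "{v \<in> H. \<rho> v \<noteq> v \<and> \<rho> v \<noteq> - v}"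
  have "(of_nat (card ?M) :: bit) = 0"
  proof (rule of_nat_card_involution_bit)
    fix v assume v: "v \<in> ?M"
    show "h v \<in> ?M" "h (h v) = v" "h v \<noteq> v"
      using v assms(2)[of v] assms(2)[of "\<rho> v"] assms(3)[of v] assms(4)[of v] assms(5)[of v]
      by (auto simp: h_def)
  qed
  moreover have "card H = card ?M + (card {v \<in> H. \<rho> v = v} + card {v \<in> H. \<rho> v = - v})"
  proof -
    have "card (?M \<union> ({v \<in> H. \<rho> v = v} \<union> {v \<in> H. \<rho> v = - v})) =
        card ?M + card ({v \<in> H. \<rho> v = v} \<union> {v \<in> H. \<rho> v = - v})"
      by (rule card_Un_disjoint) (use \<open>finite H\<close> in auto)
    also have "card ({v \<in> H. \<rho> v = v} \<union> {v \<in> H. \<rho> v = - v}) =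
        card {v \<in> H. \<rho> v = v} + card {v \<in> H. \<rho> v = - v}"
      by (rule card_Un_disjoint) (use assms(1,2) in force)+
    also have "?M \<union> ({v \<in> H. \<rho> v = v} \<union> {v \<in> H. \<rho> v = - v}) = H" by auto
    finally show ?thesis .
  qed
  ultimately show ?thesis by simp
qed

text \<open>An even weight only sees the pair {v, -v}, so the representative of each pair is free.
  This lets the residue system be chosen to suit a reflection.\<close>

lemma theta_half_system_cong:
  fixes w :: "'a::group_add \<Rightarrow> int"
  assumes "\<And>v. v \<in> S \<Longrightarrow> v \<in> T \<or> - v \<in> T" "\<And>v. v \<in> T \<Longrightarrow> v \<in> S \<or> - v \<in> S"
    and "\<And>v. v \<in> S \<Longrightarrow> - v \<notin> S" "\<And>v. v \<in> T \<Longrightarrow> - v \<notin> T"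
    and "\<And>v. w (- v) = w v"
  shows "theta S w = theta T w"
proof (rule fps_ext)
  fix n
  let ?f = "\<lambda>R v. if v \<in> R then v else - v"
  have "bij_betw (?f T) {v \<in> S. w v = int n} {v \<in> T. w v = int n}"
  proof (rule bij_betw_byWitness[where f' = "?f S"])
    show "\<forall>v\<in>{v \<in> S. w v = int n}. ?f S (?f T v) = v"
      using assms(3) by auto
    show "\<forall>v\<in>{v \<in> T. w v = int n}. ?f T (?f S v) = v"
      using assms(4) by auto
    show "?f T ` {v \<in> S. w v = int n} \<subseteq> {v \<in> T. w v = int n}"
      using assms(1,5) by fastforce
    show "?f S ` {v \<in> T. w v = int n} \<subseteq> {v \<in> S. w v = int n}"
      using assms(2,5) by fastforce
  qed
  hence "card {v \<in> S. w v = int n} = card {v \<in> T. w v = int n}"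
    by (rule bij_betw_same_card)
  thus "theta S w $ n = theta T w $ n"
    by (simp only: theta_nth)
qed

lemma square_minus_one_div_eq_iff:
  fixes x :: int
  assumes "m > 0" "m dvd x\<^sup>2 - 1"
  shows "(x\<^sup>2 - 1) div m = k \<longleftrightarrow> x\<^sup>2 = m * k + 1"
  using assms by (auto elim!: dvdE)

lemma abs_le_square_int: "\<bar>x\<bar> \<le> (x::int)\<^sup>2"
proof (cases "x = 0")
  case False
  hence "\<bar>x\<bar> * 1 \<le> \<bar>x\<bar> * \<bar>x\<bar>" by (intro mult_left_mono) auto
  thus ?thesis by (simp add: power2_eq_square)
qed simp

lemma finite_int_square_eq: "finite {x::int. x \<in> S \<and> x\<^sup>2 = N}"
proof (rule finite_subset)
  show "{x. x \<in> S \<and> x\<^sup>2 = N} \<subseteq> {-N..N}"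
  proof safe
    fix x :: int
    show "x \<in> {-x\<^sup>2..x\<^sup>2}" using abs_le_square_int[of x] by auto
  qed
qed simp

lemma theta_square_compose_nth:
  assumes "m > 0" "s > 0" "\<And>x. x \<in> S \<Longrightarrow> m dvd x\<^sup>2 - 1"
  shows "(theta S (\<lambda>x::int. (x\<^sup>2 - 1) div m) oo fps_X ^ s) $ n =
           of_nat (card {x \<in> S. int s * (x\<^sup>2 - 1) = m * int n})"
proof -
  have "int s * ((x\<^sup>2 - 1) div m) = int n \<longleftrightarrow> int s * (x\<^sup>2 - 1) = m * int n" if "x \<in> S" for x
    using assms(1,2) assms(3)[OF that] by (auto elim!: dvdE)
  hence "{x \<in> S. int s * ((x\<^sup>2 - 1) div m) = int n} = {x \<in> S. int s * (x\<^sup>2 - 1) = m * int n}"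
    by blast
  thus ?thesis by (simp add: theta_compose[OF assms(2)] theta_nth)
qed

text \<open>Clearing denominators turns a coefficient of a product into a count of solutions of a
  diagonal quadratic equation. Excluding 0 keeps the weights nonnegative, as
  \<open>theta_mult\<close> requires.\<close>

lemma theta_square_mult_nth:
  assumes "m > 0" "s > 0" "\<And>x. x \<in> S \<Longrightarrow> m dvd x\<^sup>2 - 1" "0 \<notin> S"
    and "k > 0" "t > 0" "\<And>y. y \<in> T \<Longrightarrow> k dvd y\<^sup>2 - 1" "0 \<notin> T"
  shows "((theta S (\<lambda>x::int. (x\<^sup>2 - 1) div m) oo fps_X ^ s) *
          (theta T (\<lambda>y::int. (y\<^sup>2 - 1) div k) oo fps_X ^ t)) $ n =
         of_nat (card {(x, y). x \<in> S \<and> y \<in> T \<and>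
           int s * k * (x\<^sup>2 - 1) + int t * m * (y\<^sup>2 - 1) = m * k * int n})"
proof -
  have fin: "finite {x \<in> S. int s * ((x\<^sup>2 - 1) div m) = int n}"
    if "m > 0" "s > 0" "\<And>x. x \<in> S \<Longrightarrow> m dvd x\<^sup>2 - 1" for m s n and S :: "int set"
  proof (rule finite_subset)
    show "{x \<in> S. int s * ((x\<^sup>2 - 1) div m) = int n} \<subseteq> {x. x \<in> S \<and> x\<^sup>2 = m * (int n div int s) + 1}"
    proof safe
      fix x assume x: "x \<in> S" "int s * ((x\<^sup>2 - 1) div m) = int n"
      have "(x\<^sup>2 - 1) div m = int n div int s" unfolding x(2)[symmetric] using that(2) by simp
      thus "x\<^sup>2 = m * (int n div int s) + 1"
        using square_minus_one_div_eq_iff[OF that(1) that(3)[OF x(1)]] by blast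
    qed
  qed (rule finite_int_square_eq)
  have nonneg: "int s * ((x\<^sup>2 - 1) div m) \<ge> 0" if "m > 0" "0 \<notin> S" "x \<in> S" for x m s and S :: "int set"
  proof -
    have "x\<^sup>2 > 0" using that by auto
    thus ?thesis using that by (simp add: pos_imp_zdiv_nonneg_iff)
  qed
  have iff: "int s * ((x\<^sup>2 - 1) div m) + int t * ((y\<^sup>2 - 1) div k) = int n \<longleftrightarrow>
        int s * k * (x\<^sup>2 - 1) + int t * m * (y\<^sup>2 - 1) = m * k * int n" if xy: "x \<in> S" "y \<in> T" for x y
  proof -
    obtain a b where "x\<^sup>2 - 1 = m * a" "y\<^sup>2 - 1 = k * b"
      using assms(3)[OF xy(1)] assms(7)[OF xy(2)] by (auto elim!: dvdE)
    moreover have "int s * k * (m * a) + int t * m * (k * b) = m * k * (int s * a + int t * b)"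
      by (simp add: algebra_simps)
    ultimately show ?thesis using assms(1,5) by simp
  qed
  have "{v \<in> S \<times> T. (case v of (x, y) \<Rightarrow> int s * ((x\<^sup>2 - 1) div m) + int t * ((y\<^sup>2 - 1) div k)) = int n}
      = {(x, y). x \<in> S \<and> y \<in> T \<and> int s * k * (x\<^sup>2 - 1) + int t * m * (y\<^sup>2 - 1) = m * k * int n}"
    using iff by auto
  moreover have "theta S (\<lambda>x. int s * ((x\<^sup>2 - 1) div m)) * theta T (\<lambda>y. int t * ((y\<^sup>2 - 1) div k)) =
      theta (S \<times> T) (\<lambda>(x, y). int s * ((x\<^sup>2 - 1) div m) + int t * ((y\<^sup>2 - 1) div k))"
    using assms by (intro theta_mult fin nonneg) auto
  ultimately show ?thesis
    by (simp only: theta_compose[OF assms(2)] theta_compose[OF assms(6)] theta_nth)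
qed

lemma finite_int_binary_form:
  assumes "a > 0" "b > 0"
  shows "finite {(x::int, y::int). P x y \<and> a * x\<^sup>2 + b * y\<^sup>2 = N}"
proof (rule finite_subset)
  have bound: "\<bar>x\<bar> \<le> N" if "a > 0" "b > 0" "a * x\<^sup>2 + b * y\<^sup>2 = N" for x y a b :: int
  proof -
    have "\<bar>x\<bar> \<le> 1 * x\<^sup>2" using abs_le_square_int[of x] by simp
    also have "\<dots> \<le> a * x\<^sup>2" using that(1) by (intro mult_right_mono) auto
    also have "\<dots> \<le> N" using that(2,3) by auto
    finally show ?thesis .
  qed
  show "{(x, y). P x y \<and> a * x\<^sup>2 + b * y\<^sup>2 = N} \<subseteq> {-N..N} \<times> {-N..N}"
  proof
    fix v assume "v \<in> {(x, y). P x y \<and> a * x\<^sup>2 + b * y\<^sup>2 = N}"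
    then obtain x y where v: "v = (x, y)" "a * x\<^sup>2 + b * y\<^sup>2 = N" by auto
    hence "\<bar>x\<bar> \<le> N" "\<bar>y\<bar> \<le> N" using bound[of a b x y] bound[of b a y x] assms by auto
    thus "v \<in> {-N..N} \<times> {-N..N}" by (auto simp: v(1))
  qed
qed simp

section \<open>Theta identities from reflections\<close>

text \<open>For x = 6k + 1 the weight is k (3k + 1) / 2, so this is the pentagonal series with its
  signs dropped: f_1 modulo 2.\<close>

definition pent :: "bit fps" where
  "pent = theta {x. x mod 6 = 1} (\<lambda>x::int. (x\<^sup>2 - 1) div 24)"

text \<open>For y = 4k + 1 the weight is k (2k + 1), which runs once through the triangular numbers.
  By \<open>psi_eq\<close> this is f_1^3 modulo 2.\<close>

definition psi :: "bit fps" where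
  "psi = theta {y. y mod 4 = 1} (\<lambda>y::int. (y\<^sup>2 - 1) div 8)"

lemma dvd_square_minus_one_8: "odd (y::int) \<Longrightarrow> 8 dvd y\<^sup>2 - 1"
proof -
  assume "odd y"
  then obtain j where "y = 2 * j + 1" by (rule oddE)
  hence "y\<^sup>2 - 1 = 4 * (j * (j + 1))" by (simp add: power2_eq_square algebra_simps)
  moreover obtain k where "j * (j + 1) = 2 * k" using evenE[of "j * (j + 1)"] by auto
  ultimately show ?thesis by simp
qed

lemma dvd_square_minus_one_24:
  assumes "odd (x::int)" "x mod 3 \<noteq> 0"
  shows "24 dvd x\<^sup>2 - 1"
proof -
  have "3 dvd x\<^sup>2 - 1"
  proof -
    have "x mod 3 = 1 \<or> x mod 3 = 2" using assms(2) by presburger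
    hence "x\<^sup>2 mod 3 = 1" by (auto simp: power2_eq_square mod_mult_eq[of x 3 x, symmetric])
    thus ?thesis by presburger
  qed
  with dvd_square_minus_one_8[OF assms(1)] show ?thesis by presburger
qed

lemma pent_eq_theta:
  assumes "\<And>x. x \<in> S \<Longrightarrow> odd x \<and> x mod 3 \<noteq> 0" "\<And>x. x \<in> S \<Longrightarrow> - x \<notin> S"
    and "\<And>x. x mod 6 = 1 \<Longrightarrow> x \<in> S \<or> - x \<in> S"
  shows "pent = theta S (\<lambda>x. (x\<^sup>2 - 1) div 24)"
  unfolding pent_def
proof (rule theta_half_system_cong)
  show "v \<in> {x. x mod 6 = 1} \<or> - v \<in> {x. x mod 6 = 1}" if "v \<in> S" for v
    using assms(1)[OF that] by simp presburger
  show "- v \<notin> {x. x mod 6 = 1}" if "v \<in> {x. x mod 6 = 1}" for v :: int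
    using that by simp presburger
qed (use assms in auto)

lemma psi_eq_theta:
  assumes "\<And>y. y \<in> S \<Longrightarrow> odd y" "\<And>y. y \<in> S \<Longrightarrow> - y \<notin> S"
    and "\<And>y. y mod 4 = 1 \<Longrightarrow> y \<in> S \<or> - y \<in> S"
  shows "psi = theta S (\<lambda>y. (y\<^sup>2 - 1) div 8)"
  unfolding psi_def
proof (rule theta_half_system_cong)
  show "v \<in> {y. y mod 4 = 1} \<or> - v \<in> {y. y mod 4 = 1}" if "v \<in> S" for v
    using assms(1)[OF that] by simp presburger
  show "- v \<notin> {y. y mod 4 = 1}" if "v \<in> {y. y mod 4 = 1}" for v :: int
    using that by simp presburger
qed (use assms in auto)

section \<open>The reflection of x^2 + 3y^2\<close>

text \<open>The map multiplies the conjugate of x + y sqrt(-3) by the unit (1 - sqrt(-3)) / 2, which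
  has norm 1. The image returns to the half-system up to a common sign.\<close>

lemma eisenstein_reflection:
  fixes x y :: int
  assumes "x mod 4 = 1" "y mod 4 = 1"
  obtains x' y' where "2 * x' = x - 3 * y" "2 * y' = - (x + y)"
    "x' mod 4 = 1 \<and> y' mod 4 = 1 \<or> (-x') mod 4 = 1 \<and> (-y') mod 4 = 1"
    "x'\<^sup>2 + 3 * y'\<^sup>2 = x\<^sup>2 + 3 * y\<^sup>2"
proof -
  define i j where "i = x div 4" and "j = y div 4"
  have xy: "x = 4 * i + 1" "y = 4 * j + 1"
    using assms mult_div_mod_eq[of 4 x] mult_div_mod_eq[of 4 y] by (simp_all add: i_def j_def)
  define x' y' where "x' = 2 * i - 6 * j - 1" and "y' = - (2 * i + 2 * j + 1)"
  have 1: "2 * x' = x - 3 * y" and 2: "2 * y' = - (x + y)"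
    by (simp_all add: x'_def y'_def xy)
  have "4 * (x'\<^sup>2 + 3 * y'\<^sup>2) = (2 * x')\<^sup>2 + 3 * (2 * y')\<^sup>2" by (simp add: power_mult_distrib)
  also have "\<dots> = 4 * (x\<^sup>2 + 3 * y\<^sup>2)"
    unfolding 1 2 by (simp add: power2_eq_square algebra_simps)
  finally have 3: "x'\<^sup>2 + 3 * y'\<^sup>2 = x\<^sup>2 + 3 * y\<^sup>2" by simp
  have "x' mod 4 = 1 \<and> y' mod 4 = 1 \<or> (-x') mod 4 = 1 \<and> (-y') mod 4 = 1"
  \<comment> \<open>Modulo 4 both \<open>x'\<close> and \<open>y'\<close> are congruent to 2(i + j)
    - 1, so the parity of i + j fixes their common sign.\<close>
  proof (cases "even (i + j)")
    case True
    then obtain k where "j = 2 * k - i" by (metis add_diff_cancel_left' evenE)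
    hence "- x' = 4 * (3 * k - 2 * i) + 1" "- y' = 4 * k + 1" by (simp_all add: x'_def y'_def)
    thus ?thesis by (simp only: mod_mult_self4) simp
  next
    case False
    then obtain k where "j = 2 * k + 1 - i" by (metis add_diff_cancel_left' oddE)
    hence "x' = 4 * (2 * i - 3 * k - 2) + 1" "y' = 4 * (- k - 1) + 1" by (simp_all add: x'_def y'_def)
    thus ?thesis by (simp only: mod_mult_self4) simp
  qed
  with 1 2 3 show thesis using that by blast
qed

text \<open>The reflection pairs off all solutions except those on its axes x = -3y and x = y, where
  the form becomes 12y^2 and 4y^2. The predicate \<open>P\<close> leaves room for a further
  condition that the reflection respects, such as x prime to 3.\<close>

lemma card_eisenstein:
  assumes P: "\<And>x y. P x y \<Longrightarrow> x mod 4 = 1 \<and> y mod 4 = 1"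
    "\<And>x y x' y'. P x y \<Longrightarrow> x' mod 4 = 1 \<Longrightarrow> y' mod 4 = 1 \<Longrightarrow>
       2 * x' = x - 3 * y \<or> 2 * (- x') = x - 3 * y \<Longrightarrow> P x' y'"
  shows "(of_nat (card {(x::int, y::int). P x y \<and> x\<^sup>2 + 3 * y\<^sup>2 = N}) :: bit) =
     of_nat (card {y. P (- 3 * y) y \<and> 12 * y\<^sup>2 = N}) + of_nat (card {y. P y y \<and> 4 * y\<^sup>2 = N})"
proof -
  define H where "H = {(x, y). P x y \<and> x\<^sup>2 + 3 * y\<^sup>2 = N}"
  define \<rho> :: "int \<times> int \<Rightarrow> int \<times> int"
    where "\<rho> = (\<lambda>(x, y). ((x - 3 * y) div 2, - ((x + y) div 2)))"
  have "(of_nat (card H) :: bit) =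
      of_nat (card {v \<in> H. \<rho> v = v}) + of_nat (card {v \<in> H. \<rho> v = - v})"
  proof (rule card_half_system_reflection)
    show "finite H"
      using finite_int_binary_form[of 1 3 P N] by (simp add: H_def)
    fix v assume v: "v \<in> H"
    obtain x y where xy: "v = (x, y)" by (cases v)
    have "P x y" and N: "x\<^sup>2 + 3 * y\<^sup>2 = N" using v by (auto simp: H_def xy)
    note m = P(1)[OF \<open>P x y\<close>]
    show "- v \<notin> H"
    proof -
      have "- x mod 4 \<noteq> 1" using m by presburger
      thus ?thesis using P(1)[of "- x" "- y"] by (auto simp: H_def xy)
    qed
    obtain x' y' where refl: "2 * x' = x - 3 * y" "2 * y' = - (x + y)"
      "x' mod 4 = 1 \<and> y' mod 4 = 1 \<or> (-x') mod 4 = 1 \<and> (-y') mod 4 = 1"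
      "x'\<^sup>2 + 3 * y'\<^sup>2 = x\<^sup>2 + 3 * y\<^sup>2"
      using eisenstein_reflection m by metis
    have x'y': "(x - 3 * y) div 2 = x'" "(x + y) div 2 = - y'"
      using refl(1,2) by linarith+
    hence \<rho>: "\<rho> v = (x', y')" by (simp add: xy \<rho>_def)
    have "P x' y' \<or> P (- x') (- y')"
      using P(2)[OF \<open>P x y\<close>, of x' y'] P(2)[OF \<open>P x y\<close>, of "- x'" "- y'"] refl(1,3) by auto
    thus "\<rho> v \<in> H \<or> - \<rho> v \<in> H"
      using refl(4) N by (auto simp: H_def \<rho>)
    have "(x' - 3 * y') div 2 = x" "(x' + y') div 2 = - y"
      "(- x' + 3 * y') div 2 = - x" "(- x' - y') div 2 = y"
      using refl(1,2) by linarith+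
    thus "\<rho> (\<rho> v) = v" "\<rho> (- \<rho> v) = - v"
      unfolding \<rho> by (simp_all add: xy \<rho>_def)
  qed
  moreover have "\<rho> (x, y) = (x, y) \<longleftrightarrow> x = - 3 * y" "\<rho> (x, y) = - (x, y) \<longleftrightarrow> x = y"
    if xy: "P x y" for x y
  proof -
    obtain x' y' where refl: "2 * x' = x - 3 * y" "2 * y' = - (x + y)"
      using eisenstein_reflection P(1)[OF xy] by metis
    have "(x - 3 * y) div 2 = x'" "(x + y) div 2 = - y'"
      using refl by linarith+
    thus "\<rho> (x, y) = (x, y) \<longleftrightarrow> x = - 3 * y" "\<rho> (x, y) = - (x, y) \<longleftrightarrow> x = y"
      using refl by (auto simp: \<rho>_def)
  qed
  hence "{v \<in> H. \<rho> v = v} = (\<lambda>y. (- 3 * y, y)) ` {y. P (- 3 * y) y \<and> 12 * y\<^sup>2 = N}"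
    "{v \<in> H. \<rho> v = - v} = (\<lambda>y. (y, y)) ` {y. P y y \<and> 4 * y\<^sup>2 = N}"
    by (force simp: H_def power_mult_distrib)+
  ultimately show ?thesis
    by (simp add: card_image inj_on_def H_def)
qed

text \<open>With x prime to 3 the axis x = -3y is empty, and the axis x = y gives 4(x^2 - 1) = 24n,
  which is f_4. Since f_4 = f_1^4, this is what yields psi = f_1^3.\<close>

lemma pent_times_psi: "pent * psi = pent oo fps_X ^ 4"
proof (rule fps_ext)
  fix n
  \<comment> \<open>Signs are normalized modulo 4 instead of modulo 6, because the reflection acts
    on residues modulo 4.\<close>
  define S :: "int set" where "S = {x. x mod 4 = 1 \<and> x mod 3 \<noteq> 0}"
  have pent: "pent = theta S (\<lambda>x. (x\<^sup>2 - 1) div 24)"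
    by (rule pent_eq_theta) (unfold S_def mem_Collect_eq, presburger+)
  have "(pent * psi) $ n = ((pent oo fps_X ^ 1) * (psi oo fps_X ^ 1)) $ n" by simp
  also have "\<dots> = of_nat (card {(x, y). x \<in> S \<and> y \<in> {y. y mod 4 = 1} \<and>
      int 1 * 8 * (x\<^sup>2 - 1) + int 1 * 24 * (y\<^sup>2 - 1) = 24 * 8 * int n})"
    unfolding pent psi_def
  proof (rule theta_square_mult_nth)
    show "24 dvd x\<^sup>2 - 1" if "x \<in> S" for x
      by (rule dvd_square_minus_one_24) (use that in \<open>unfold S_def mem_Collect_eq, presburger+\<close>)
    show "8 dvd y\<^sup>2 - 1" if "y \<in> {y. y mod 4 = 1}" for y :: int
      by (rule dvd_square_minus_one_8) (use that in \<open>unfold mem_Collect_eq, presburger\<close>)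
  qed (auto simp: S_def)
  also have "{(x, y). x \<in> S \<and> y \<in> {y. y mod 4 = 1} \<and>
        int 1 * 8 * (x\<^sup>2 - 1) + int 1 * 24 * (y\<^sup>2 - 1) = 24 * 8 * int n} =
      {(x, y). (x \<in> S \<and> y mod 4 = 1) \<and> x\<^sup>2 + 3 * y\<^sup>2 = 24 * int n + 4}"
    by (auto simp: algebra_simps)
  also have "of_nat (card \<dots>) =
      (of_nat (card {y. (- 3 * y \<in> S \<and> y mod 4 = 1) \<and> 12 * y\<^sup>2 = 24 * int n + 4}) +
       of_nat (card {y. (y \<in> S \<and> y mod 4 = 1) \<and> 4 * y\<^sup>2 = 24 * int n + 4}) :: bit)"
  proof (rule card_eisenstein)
    show "x' \<in> S \<and> y' mod 4 = 1"
      if "x \<in> S \<and> y mod 4 = 1" "x' mod 4 = 1" "y' mod 4 = 1"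
        "2 * x' = x - 3 * y \<or> 2 * (- x') = x - 3 * y" for x y x' y'
    proof -
      have "x' mod 3 \<noteq> 0"
      proof
        assume "x' mod 3 = 0"
        hence "3 dvd x'" by auto
        hence "3 dvd x" using that(4) by presburger
        thus False using that(1) by (auto simp: S_def)
      qed
      thus ?thesis using that by (simp add: S_def)
    qed
  qed (auto simp: S_def)
  also have "{y. (- 3 * y \<in> S \<and> y mod 4 = 1) \<and> 12 * y\<^sup>2 = 24 * int n + 4} = {}"
    by (auto simp: S_def)
  also have "{y. (y \<in> S \<and> y mod 4 = 1) \<and> 4 * y\<^sup>2 = 24 * int n + 4} =
      {x \<in> S. int 4 * (x\<^sup>2 - 1) = 24 * int n}"
    by (auto simp: S_def)
  also have "of_nat (card {}) + of_nat (card {x \<in> S. int 4 * (x\<^sup>2 - 1) = 24 * int n}) =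
      (pent oo fps_X ^ 4) $ n"
    unfolding pent
  proof (subst theta_square_compose_nth)
    show "24 dvd x\<^sup>2 - 1" if "x \<in> S" for x
      by (rule dvd_square_minus_one_24) (use that in \<open>unfold S_def mem_Collect_eq, presburger+\<close>)
  qed auto
  finally show "(pent * psi) $ n = (pent oo fps_X ^ 4) $ n" .
qed

lemma psi_compose_nth:
  "s > 0 \<Longrightarrow> (psi oo fps_X ^ s) $ n = of_nat (card {y. y mod 4 = 1 \<and> int s * (y\<^sup>2 - 1) = 8 * int n})"
  unfolding psi_def
proof (subst theta_square_compose_nth)
  show "8 dvd y\<^sup>2 - 1" if "y \<in> {y. y mod 4 = 1}" for y :: int
    by (rule dvd_square_minus_one_8) (use that in \<open>unfold mem_Collect_eq, presburger\<close>)
qed auto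

text \<open>Here both axes survive: x = y gives 4(y^2 - 1) = 8n, and x = -3y gives 12(y^2 - 1) = 8(n
  - 1), whence the factor X.\<close>

lemma psi_times_psi_3:
  "psi * (psi oo fps_X ^ 3) = (psi oo fps_X ^ 4) + fps_X * (psi oo fps_X ^ 12)"
proof (rule fps_ext)
  fix n
  have dvd: "8 dvd y\<^sup>2 - 1" if "y \<in> {y. y mod 4 = 1}" for y :: int
    by (rule dvd_square_minus_one_8) (use that in \<open>unfold mem_Collect_eq, presburger\<close>)
  have "(psi * (psi oo fps_X ^ 3)) $ n = ((psi oo fps_X ^ 1) * (psi oo fps_X ^ 3)) $ n" by simp
  also have "\<dots> = of_nat (card {(x, y). x \<in> {y. y mod 4 = 1} \<and> y \<in> {y. y mod 4 = 1} \<and>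
      int 1 * 8 * (x\<^sup>2 - 1) + int 3 * 8 * (y\<^sup>2 - 1) = 8 * 8 * int n})"
    unfolding psi_def by (rule theta_square_mult_nth) (use dvd in auto)
  also have "{(x, y). x \<in> {y. y mod 4 = 1} \<and> y \<in> {y. y mod 4 = 1} \<and>
        int 1 * 8 * (x\<^sup>2 - 1) + int 3 * 8 * (y\<^sup>2 - 1) = 8 * 8 * int n} =
      {(x, y). (x mod 4 = 1 \<and> y mod 4 = 1) \<and> x\<^sup>2 + 3 * y\<^sup>2 = 8 * int n + 4}"
    by (auto simp: algebra_simps)
  also have "of_nat (card \<dots>) =
      (of_nat (card {y. (- 3 * y mod 4 = 1 \<and> y mod 4 = 1) \<and> 12 * y\<^sup>2 = 8 * int n + 4}) +
       of_nat (card {y. (y mod 4 = 1 \<and> y mod 4 = 1) \<and> 4 * y\<^sup>2 = 8 * int n + 4}) :: bit)"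
    by (rule card_eisenstein) auto
  also have "{y. (- 3 * y mod 4 = 1 \<and> y mod 4 = 1) \<and> 12 * y\<^sup>2 = 8 * int n + 4} =
      {y. y mod 4 = 1 \<and> 12 * y\<^sup>2 = 8 * int n + 4}"
  proof -
    have "- 3 * y mod 4 = 1" if "y mod 4 = 1" for y :: int using that by presburger
    thus ?thesis by blast
  qed
  also have "of_nat (card \<dots>) = (fps_X * (psi oo fps_X ^ 12)) $ n"
  proof (cases n)
    case 0
    have "12 * y\<^sup>2 \<noteq> 4" for y :: int by presburger
    thus ?thesis by (simp add: 0)
  next
    case (Suc m)
    have "{y. y mod 4 = 1 \<and> 12 * y\<^sup>2 = 8 * int n + 4} = {y. y mod 4 = 1 \<and> int 12 * (y\<^sup>2 - 1) = 8 * int m}"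
      by (auto simp: Suc)
    thus ?thesis by (simp add: Suc psi_compose_nth)
  qed
  also have "{y. (y mod 4 = 1 \<and> y mod 4 = 1) \<and> 4 * y\<^sup>2 = 8 * int n + 4} =
      {y. y mod 4 = 1 \<and> int 4 * (y\<^sup>2 - 1) = 8 * int n}"
    by auto
  also have "of_nat (card \<dots>) = (psi oo fps_X ^ 4) $ n"
    by (simp add: psi_compose_nth)
  finally show "(psi * (psi oo fps_X ^ 3)) $ n =
      ((psi oo fps_X ^ 4) + fps_X * (psi oo fps_X ^ 12)) $ n" by (simp only: fps_add_nth add.commute)
qed

section \<open>The reflection of x^2 + 5y^2\<close>

text \<open>Divisibility of x + y by 3 makes the image integral. The invariance of x + y later
  determines the residues of the image modulo 6.\<close>

lemma sqrt_minus_5_reflection: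
  fixes x y :: int
  assumes "(x + y) mod 6 = 0"
  obtains x' y' where "3 * x' = 2 * x + 5 * y" "3 * y' = x - 2 * y" "x' + y' = x + y"
    "x'\<^sup>2 + 5 * y'\<^sup>2 = x\<^sup>2 + 5 * y\<^sup>2"
proof -
  define k where "k = (x + y) div 6"
  have x: "x = 6 * k - y"
    using assms mult_div_mod_eq[of 6 "x + y"] by (simp add: k_def)
  define x' y' where "x' = 4 * k + y" and "y' = 2 * k - y"
  have 1: "3 * x' = 2 * x + 5 * y" and 2: "3 * y' = x - 2 * y" and 3: "x' + y' = x + y"
    by (simp_all add: x'_def y'_def x)
  have "9 * (x'\<^sup>2 + 5 * y'\<^sup>2) = (3 * x')\<^sup>2 + 5 * (3 * y')\<^sup>2" by (simp add: power_mult_distrib)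
  also have "\<dots> = 9 * (x\<^sup>2 + 5 * y\<^sup>2)"
    unfolding 1 2 by (simp add: power2_eq_square algebra_simps)
  finally have "x'\<^sup>2 + 5 * y'\<^sup>2 = x\<^sup>2 + 5 * y\<^sup>2" by simp
  with 1 2 3 show thesis by (rule that)
qed

text \<open>The reflection multiplies the conjugate of \<open>x + y \<surd>-5\<close> by \<open>(2 + \<surd>-5) / 3\<close>. It need not preserve
  coprimality to \<open>3\<close>, so the pairs divisible by \<open>3\<close> are added; these occur in couples
  \<open>(x, y)\<close>, \<open>(x, -y)\<close>.\<close>

lemma card_coprime_6_form:
  "(of_nat (card {(x::int, y::int). x mod 6 = 1 \<and> y mod 6 = 5 \<and> x\<^sup>2 + 5 * y\<^sup>2 = N}) :: bit) =
     of_nat (card {y. (y mod 6 = 5 \<or> y mod 6 = 3 \<and> y > 0) \<and> 30 * y\<^sup>2 = N}) +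
     of_nat (card {y. (y mod 6 = 5 \<or> y mod 6 = 3 \<and> y < 0) \<and> 6 * y\<^sup>2 = N})"
proof -
  \<comment> \<open>\<open>P\<close> picks one of each v, -v among the odd pairs with 6 dividing x +
    y. When both entries are divisible by 3, the residues do not separate v from -v and the sign of
    x decides.\<close>
  define P :: "int \<Rightarrow> int \<Rightarrow> bool"
    where "P x y \<longleftrightarrow> x mod 6 = 1 \<and> y mod 6 = 5 \<or> x mod 6 = 3 \<and> y mod 6 = 3 \<and> x > 0" for x y
  have P6: "(x + y) mod 6 = 0 \<and> odd y" if "P x y" for x y
    using that unfolding P_def by presburger
  have m: "z mod 6 = r" if "z = 6 * c + r" "r \<in> {1, 3, 5}" for z c r :: int
    using that by auto
  define H where "H = {(x, y). P x y \<and> x\<^sup>2 + 5 * y\<^sup>2 = N}"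
  define C where "C = {(x::int, y::int). x mod 6 = 1 \<and> y mod 6 = 5 \<and> x\<^sup>2 + 5 * y\<^sup>2 = N}"
  define D where "D = {(x::int, y::int). (x mod 6 = 3 \<and> y mod 6 = 3 \<and> x > 0) \<and> x\<^sup>2 + 5 * y\<^sup>2 = N}"
  define \<rho> :: "int \<times> int \<Rightarrow> int \<times> int"
    where "\<rho> = (\<lambda>(x, y). ((2 * x + 5 * y) div 3, (x - 2 * y) div 3))"
  have fin: "finite H" using finite_int_binary_form[of 1 5 P N] by (simp add: H_def)
  have H: "H = C \<union> D" "C \<inter> D = {}" by (auto simp: H_def C_def D_def P_def)
  have \<rho>_iff: "\<rho> (x, y) = (x, y) \<longleftrightarrow> x = 5 * y" "\<rho> (x, y) = - (x, y) \<longleftrightarrow> x = - y"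
    if P: "P x y" for x y
  proof -
    obtain x' y' where refl: "3 * x' = 2 * x + 5 * y" "3 * y' = x - 2 * y"
      using sqrt_minus_5_reflection[OF P6[OF P, THEN conjunct1]] by metis
    have "\<rho> (x, y) = (x', y')" by (simp add: \<rho>_def flip: refl)
    thus "\<rho> (x, y) = (x, y) \<longleftrightarrow> x = 5 * y" "\<rho> (x, y) = - (x, y) \<longleftrightarrow> x = - y"
      using refl by auto
  qed
  have "(of_nat (card D) :: bit) = 0"
  proof (rule of_nat_card_involution_bit[where h = "\<lambda>(x, y). (x, - y)"])
    fix v assume v: "v \<in> D"
    obtain x y where xy: "v = (x, y)" by (cases v)
    have "y mod 6 = 3" using v by (simp add: D_def xy)
    hence "- y mod 6 = 3 \<and> - y \<noteq> y" by presburger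
    thus "(case v of (x, y) \<Rightarrow> (x, - y)) \<in> D" "(case v of (x, y) \<Rightarrow> (x, - y)) \<noteq> v"
      "(case case v of (x, y) \<Rightarrow> (x, - y) of (x, y) \<Rightarrow> (x, - y)) = v"
      using v by (auto simp: D_def xy)
  qed
  moreover have "card H = card C + card D"
    unfolding H(1) by (rule card_Un_disjoint) (use H fin in auto)
  ultimately have "(of_nat (card C) :: bit) = of_nat (card H)" by simp
  also have "\<dots> = of_nat (card {v \<in> H. \<rho> v = v}) + of_nat (card {v \<in> H. \<rho> v = - v})"
  proof (rule card_half_system_reflection[OF fin])
    fix v assume v: "v \<in> H"
    obtain x y where xy: "v = (x, y)" by (cases v)
    have "P x y" and N: "x\<^sup>2 + 5 * y\<^sup>2 = N" using v by (auto simp: H_def xy)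
    obtain x' y' where refl: "3 * x' = 2 * x + 5 * y" "3 * y' = x - 2 * y" "x' + y' = x + y"
      "x'\<^sup>2 + 5 * y'\<^sup>2 = x\<^sup>2 + 5 * y\<^sup>2"
      using sqrt_minus_5_reflection[OF P6[OF \<open>P x y\<close>, THEN conjunct1]] by metis
    have \<rho>: "\<rho> v = (x', y')" by (simp add: xy \<rho>_def flip: refl(1,2))
    have "\<not> P (- x) (- y)"
      using \<open>P x y\<close> unfolding P_def by presburger
    thus "- v \<notin> H" by (auto simp: H_def xy)
    have "odd x'"
      using P6[OF \<open>P x y\<close>] arg_cong[OF refl(1), of even] by simp
    have "P x' y' \<or> P (- x') (- y')"
    proof -
      define a where "a = x' div 6"
      obtain k where "x' + y' = 6 * k"
        using P6[OF \<open>P x y\<close>] refl(3) by (auto elim!: dvdE)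
      hence y': "y' = 6 * k - x'" by simp
      have "x' mod 6 = 1 \<or> x' mod 6 = 3 \<or> x' mod 6 = 5" using \<open>odd x'\<close> by presburger
      hence "x' = 6 * a + 1 \<or> x' = 6 * a + 3 \<or> x' = 6 * a + 5"
        using mult_div_mod_eq[of 6 x'] unfolding a_def by metis
      thus ?thesis
      proof (elim disjE)
        assume x': "x' = 6 * a + 1"
        hence "y' = 6 * (k - a - 1) + 5" using y' by simp
        hence "x' mod 6 = 1" "y' mod 6 = 5" using x' m by blast+
        thus ?thesis by (simp add: P_def)
      next
        assume x': "x' = 6 * a + 3"
        hence "y' = 6 * (k - a - 1) + 3" "- y' = 6 * (a - k) + 3" "- x' = 6 * (- a - 1) + 3"
          using y' by simp_all
        hence "x' mod 6 = 3" "y' mod 6 = 3" "- x' mod 6 = 3" "- y' mod 6 = 3"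
          using x' m by blast+
        moreover have "x' > 0 \<or> - x' > 0" using x' by presburger
        ultimately show ?thesis
          unfolding P_def by blast
      next
        assume x': "x' = 6 * a + 5"
        hence "- y' = 6 * (a - k) + 5" "- x' = 6 * (- a - 1) + 1"
          using y' by simp_all
        hence "- x' mod 6 = 1" "- y' mod 6 = 5" using m by blast+
        thus ?thesis by (simp add: P_def)
      qed
    qed
    thus "\<rho> v \<in> H \<or> - \<rho> v \<in> H"
      using refl(4) N by (auto simp: H_def \<rho>)
    have \<rho>_eq: "\<rho> (u, w) = (p, r)" if "2 * u + 5 * w = 3 * p" "u - 2 * w = 3 * r" for u w p r
      by (simp add: \<rho>_def that)
    show "\<rho> (\<rho> v) = v" unfolding \<rho> unfolding xy using refl(1,2) by (intro \<rho>_eq) simp_all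
    show "\<rho> (- \<rho> v) = - v" unfolding \<rho> unfolding xy uminus_Pair using refl(1,2)
      by (intro \<rho>_eq) simp_all
  qed
  \<comment> \<open>On the axis x = 5y the condition x > 0 reads y > 0; on the axis x = -y it reads
    y < 0.\<close>
  also have "{v \<in> H. \<rho> v = v} =
      (\<lambda>y. (5 * y, y)) ` {y. (y mod 6 = 5 \<or> y mod 6 = 3 \<and> y > 0) \<and> 30 * y\<^sup>2 = N}"
  proof -
    have "5 * y mod 6 = 1" if "y mod 6 = 5" for y :: int using mod_mult_right_eq[of 5 y 6] that by simp
    moreover have "5 * y mod 6 = 3" if "y mod 6 = 3" for y :: int using mod_mult_right_eq[of 5 y 6] that by simp
    ultimately have "P (5 * y) y \<longleftrightarrow> y mod 6 = 5 \<or> y mod 6 = 3 \<and> y > 0" for y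
      by (auto simp: P_def)
    thus ?thesis using \<rho>_iff(1) by (force simp: H_def power_mult_distrib)
  qed
  also have "{v \<in> H. \<rho> v = - v} =
      (\<lambda>y. (- y, y)) ` {y. (y mod 6 = 5 \<or> y mod 6 = 3 \<and> y < 0) \<and> 6 * y\<^sup>2 = N}"
  proof -
    have "- y mod 6 = 1" if "y mod 6 = 5" for y :: int using that by (simp add: zmod_zminus1_eq_if)
    moreover have "- y mod 6 = 3" if "y mod 6 = 3" for y :: int using that by (simp add: zmod_zminus1_eq_if)
    ultimately have "P (- y) y \<longleftrightarrow> y mod 6 = 5 \<or> y mod 6 = 3 \<and> y < 0" for y
      by (auto simp: P_def)
    thus ?thesis using \<rho>_iff(2) by (force simp: H_def)
  qed
  finally show ?thesis
    by (simp add: card_image inj_on_def C_def)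
qed

text \<open>The class of 3 modulo 6 is closed under negation, so there a sign condition must choose
  the representative. The two choices of \<open>Q\<close> match the two axes of the
  reflection.\<close>

lemma psi_eq_theta_mod_6:
  defines "Y \<equiv> \<lambda>Q. {y::int. y mod 6 = 5 \<or> y mod 6 = 3 \<and> Q y}"
  assumes Q: "Q = (\<lambda>y. y > 0) \<or> Q = (\<lambda>y. y < 0)"
  shows "psi = theta (Y Q) (\<lambda>y. (y\<^sup>2 - 1) div 8)"
proof (rule psi_eq_theta)
  show "odd y" if "y \<in> Y Q" for y
  proof -
    have "y mod 6 = 5 \<or> y mod 6 = 3" using that by (auto simp: Y_def)
    thus ?thesis by presburger
  qed
  show "- y \<notin> Y Q" if "y \<in> Y Q" for y
    using that Q by (auto simp: Y_def zmod_zminus1_eq_if)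
  show "y \<in> Y Q \<or> - y \<in> Y Q" if "y mod 4 = 1" for y
  proof -
    have "y mod 6 = 1 \<or> y mod 6 = 3 \<or> y mod 6 = 5" "y \<noteq> 0" using that by presburger+
    thus ?thesis using Q by (auto simp: Y_def zmod_zminus1_eq_if)
  qed
qed

text \<open>Coefficient n counts solutions of x^2 + 5y^2 = 24n + 6. The axis x = -y gives 6(y^2 - 1)
  = 24n, and x = 5y gives 30(y^2 - 1) = 24(n - 1). With psi = f_1^3 this becomes ac = a^6 +
  qc^6.\<close>

lemma pent_times_pent_5:
  "pent * (pent oo fps_X ^ 5) = (psi oo fps_X ^ 2) + fps_X * (psi oo fps_X ^ 10)"
proof (rule fps_ext)
  fix n
  have psi_nth: "(psi oo fps_X ^ s) $ n =
      of_nat (card {y. (y mod 6 = 5 \<or> y mod 6 = 3 \<and> Q y) \<and> int s * (y\<^sup>2 - 1) = 8 * int n})"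
    if "s > 0" "Q = (\<lambda>y. y > 0) \<or> Q = (\<lambda>y. y < 0)"
    for s n Q
  proof -
    have "8 dvd y\<^sup>2 - 1" if "y mod 6 = 5 \<or> y mod 6 = 3 \<and> Q y" for y
    proof (rule dvd_square_minus_one_8)
      have "y mod 6 = 5 \<or> y mod 6 = 3" using that by blast
      thus "odd y" by presburger
    qed
    thus ?thesis
      unfolding psi_eq_theta_mod_6[OF \<open>_ \<or> _\<close>] using \<open>s > 0\<close>
      by (subst theta_square_compose_nth) auto
  qed
  \<comment> \<open>The second factor uses the opposite residue class, so that x + y is divisible by
    6 and the reflection applies.\<close>
  have pent: "pent = theta {y. y mod 6 = 5} (\<lambda>x. (x\<^sup>2 - 1) div 24)"
    by (rule pent_eq_theta) (unfold mem_Collect_eq, presburger+)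
  have dvd: "24 dvd x\<^sup>2 - 1" if "x mod 6 = 1 \<or> x mod 6 = 5" for x :: int
    by (rule dvd_square_minus_one_24) (use that in presburger)+
  have "(pent * (pent oo fps_X ^ 5)) $ n = ((pent oo fps_X ^ 1) * (pent oo fps_X ^ 5)) $ n" by simp
  also have "\<dots> = of_nat (card {(x, y). x \<in> {x. x mod 6 = 1} \<and> y \<in> {y. y mod 6 = 5} \<and>
      int 1 * 24 * (x\<^sup>2 - 1) + int 5 * 24 * (y\<^sup>2 - 1) = 24 * 24 * int n})"
  proof (subst (2) pent, subst pent_def, rule theta_square_mult_nth)
  qed (use dvd in auto)
  also have "{(x, y). x \<in> {x. x mod 6 = 1} \<and> y \<in> {y. y mod 6 = 5} \<and>
        int 1 * 24 * (x\<^sup>2 - 1) + int 5 * 24 * (y\<^sup>2 - 1) = 24 * 24 * int n} =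
      {(x, y). x mod 6 = 1 \<and> y mod 6 = 5 \<and> x\<^sup>2 + 5 * y\<^sup>2 = 24 * int n + 6}"
    by (auto simp: algebra_simps)
  also note card_coprime_6_form
  also have "of_nat (card {y. (y mod 6 = 5 \<or> y mod 6 = 3 \<and> y > 0) \<and> 30 * y\<^sup>2 = 24 * int n + 6}) =
      (fps_X * (psi oo fps_X ^ 10)) $ n"
  proof (cases n)
    case 0
    have "30 * y\<^sup>2 \<noteq> 6" for y :: int by presburger
    thus ?thesis by (simp add: 0)
  next
    case (Suc m)
    have "{y. (y mod 6 = 5 \<or> y mod 6 = 3 \<and> y > 0) \<and> 30 * y\<^sup>2 = 24 * int n + 6} =
        {y. (y mod 6 = 5 \<or> y mod 6 = 3 \<and> y > 0) \<and> int 10 * (y\<^sup>2 - 1) = 8 * int m}"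
      by (auto simp: Suc)
    thus ?thesis
      by (simp add: Suc psi_nth[where Q = "\<lambda>y. y > 0"])
  qed
  also have "{y. (y mod 6 = 5 \<or> y mod 6 = 3 \<and> y < 0) \<and> 6 * y\<^sup>2 = 24 * int n + 6} =
      {y. (y mod 6 = 5 \<or> y mod 6 = 3 \<and> y < 0) \<and> int 2 * (y\<^sup>2 - 1) = 8 * int n}"
    by auto
  also have "of_nat (card \<dots>) = (psi oo fps_X ^ 2) $ n"
    by (rule psi_nth[where Q = "\<lambda>y. y < 0", symmetric]) auto
  finally show "(pent * (pent oo fps_X ^ 5)) $ n =
      ((psi oo fps_X ^ 2) + fps_X * (psi oo fps_X ^ 10)) $ n" by (simp only: fps_add_nth add.commute)
qed

section \<open>Even and odd parts\<close>

definition even_part :: "bit fps \<Rightarrow> bit fps" where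
  "even_part F = Abs_fps (\<lambda>n. F $ (2 * n))"

definition odd_part :: "bit fps \<Rightarrow> bit fps" where
  "odd_part F = Abs_fps (\<lambda>n. F $ (2 * n + 1))"

lemma bit_fps_two: "(2 :: bit fps) = 0"
  by (rule fps_ext) (simp add: numeral_fps_const)

lemma bit_fps_add_self: "F + F = (0 :: bit fps)"
  by (rule fps_ext) simp

lemma bit_fps_add_eq_iff: "A + B = C \<longleftrightarrow> A = C + (B :: bit fps)"
  by (metis add.assoc add.right_neutral bit_fps_add_self)

text \<open>The convolution terms at i and n - i cancel, which leaves only the diagonal i = n /
  2.\<close>

lemma bit_fps_square_nth: "((F :: bit fps)\<^sup>2) $ n = (if even n then F $ (n div 2) else 0)"
proof -
  have cancel: "(\<Sum>i\<in>{0..n} - {i. 2 * i = n}. F $ i * F $ (n - i)) = 0"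
  proof (rule sum_involution_eq_0[where h = "\<lambda>i. n - i"])
    show "F $ (n - i) * F $ (n - (n - i)) + F $ i * F $ (n - i) = 0"
      if "i \<in> {0..n} - {i. 2 * i = n}" for i
    proof -
      have "n - (n - i) = i" using that by auto
      thus ?thesis by (simp only: mult.commute[of "F $ i"]) simp
    qed
  qed auto
  have "(F\<^sup>2) $ n = (\<Sum>i=0..n. F $ i * F $ (n - i))"
    by (simp only: power2_eq_square fps_mult_nth)
  also have "\<dots> = (\<Sum>i\<in>{i. 2 * i = n}. F $ i * F $ (n - i)) +
      (\<Sum>i\<in>{0..n} - {i. 2 * i = n}. F $ i * F $ (n - i))"
    by (subst add.commute, rule sum.subset_diff) auto
  also have "\<dots> = (\<Sum>i\<in>{i. 2 * i = n}. F $ i * F $ (n - i))"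
    unfolding cancel by simp
  also have "\<dots> = (if even n then F $ (n div 2) else 0)"
  proof (cases "even n")
    case True
    then obtain k where n: "n = 2 * k" by (rule evenE)
    have "{i. 2 * i = n} = {k}" using n by auto
    thus ?thesis by (cases "F $ k") (auto simp: n)
  next
    case False
    hence "{i. 2 * i = n} = {}" by auto
    thus ?thesis using False by simp
  qed
  finally show ?thesis .
qed

text \<open>Since G(q^2) = G(q)^2 over this field, the 2-dissection needs no substitution and
  becomes algebra in a single ring.\<close>

lemma even_odd_decomposition: "F = (even_part F)\<^sup>2 + fps_X * (odd_part F)\<^sup>2"
proof (rule fps_ext)
  fix n
  show "F $ n = ((even_part F)\<^sup>2 + fps_X * (odd_part F)\<^sup>2) $ n"
  proof (cases "even n")
    case True
    thus ?thesis by (simp add: bit_fps_square_nth even_part_def)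
  next
    case False
    then obtain k where "n = 2 * k + 1" by (rule oddE)
    thus ?thesis by (simp add: bit_fps_square_nth odd_part_def)
  qed
qed

lemma
  shows even_part_eq: "even_part (A\<^sup>2 + fps_X * B\<^sup>2) = A"
    and odd_part_eq: "odd_part (A\<^sup>2 + fps_X * B\<^sup>2) = B"
  by (rule fps_ext, simp add: bit_fps_square_nth even_part_def odd_part_def)+

text \<open>A square is a series in q^2, so it leaves either part as its root.\<close>

lemma
  shows even_part_mult_square: "even_part (F * G\<^sup>2) = even_part F * G"
    and odd_part_mult_square: "odd_part (F * G\<^sup>2) = odd_part F * G"
proof -
  have "F * G\<^sup>2 = (even_part F * G)\<^sup>2 + fps_X * (odd_part F * G)\<^sup>2"
    by (subst (1) even_odd_decomposition[of F]) (simp add: algebra_simps power_mult_distrib)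
  thus "even_part (F * G\<^sup>2) = even_part F * G" "odd_part (F * G\<^sup>2) = odd_part F * G"
    by (metis even_part_eq, metis odd_part_eq)
qed

lemma even_part_fps_X_mult: "even_part (fps_X * F) = fps_X * odd_part F"
  by (rule fps_ext)
    (auto simp: even_part_def odd_part_def numeral_2_eq_2 intro!: arg_cong[of _ _ "fps_nth F"])

lemma odd_part_fps_X_mult: "odd_part (fps_X * F) = even_part F"
  by (rule fps_ext) (simp add: even_part_def odd_part_def)

lemma even_part_add: "even_part (F + G) = even_part F + even_part G"
  by (rule fps_ext) (simp add: even_part_def)

lemma odd_part_add: "odd_part (F + G) = odd_part F + odd_part G"
  by (rule fps_ext) (simp add: odd_part_def)

lemma bit_fps_square_add: "(F + G :: bit fps)\<^sup>2 = F\<^sup>2 + G\<^sup>2"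
  by (simp add: power2_sum bit_fps_two)

lemma
  shows even_part_mult: "even_part (F * G) = even_part F * even_part G + fps_X * (odd_part F * odd_part G)"
    and odd_part_mult: "odd_part (F * G) = even_part F * odd_part G + odd_part F * even_part G"
proof -
  have "F * G = ((even_part F)\<^sup>2 + fps_X * (odd_part F)\<^sup>2) * ((even_part G)\<^sup>2 + fps_X * (odd_part G)\<^sup>2)"
    by (simp flip: even_odd_decomposition)
  also have "\<dots> = (even_part F * even_part G + fps_X * (odd_part F * odd_part G))\<^sup>2 +
      fps_X * (even_part F * odd_part G + odd_part F * even_part G)\<^sup>2"
    unfolding bit_fps_square_add by (simp add: algebra_simps power2_eq_square)
  finally have "F * G = \<dots>" .
  thus "even_part (F * G) = even_part F * even_part G + fps_X * (odd_part F * odd_part G)"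
    "odd_part (F * G) = even_part F * odd_part G + odd_part F * even_part G"
    by (metis even_part_eq, metis odd_part_eq)
qed

section \<open>The Hecke relation and the 2-dissections of the generating function\<close>

text \<open>Expanding E = (ac)(bd) exhibits S as the odd part of E. Expanding E^3 = (ab)^3 (cd)^3
  exhibits S^2 as the odd part of E * E^2, while pulling out the square E^2 gives S * E. Cancelling
  S, which has nonzero constant term, yields S = E.\<close>

lemma odd_part_euler_product:
  fixes a b c d :: "bit fps"
  defines "E \<equiv> a * b * c * d" and "S \<equiv> (b * c) ^ 3 + fps_X * (a * d) ^ 3"
  assumes ac: "a * c = a ^ 6 + fps_X * c ^ 6" and bd: "b * d = b ^ 6 + fps_X ^ 3 * d ^ 6"
    and ab: "(a * b) ^ 3 = a ^ 12 + fps_X * b ^ 12" and cd: "(c * d) ^ 3 = c ^ 12 + fps_X ^ 5 * d ^ 12"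
    and nz: "b $ 0 \<noteq> 0" "c $ 0 \<noteq> 0"
  shows "S = E" "odd_part E = E" "even_part E = (a * b) ^ 3 + fps_X ^ 2 * (c * d) ^ 3"
proof -
  let ?T = "(a * b) ^ 3 + fps_X ^ 2 * (c * d) ^ 3"
  have "E = (a * c) * (b * d)" by (simp add: E_def mult_ac)
  also have "\<dots> = ?T\<^sup>2 + fps_X * S\<^sup>2"
    unfolding ac bd S_def bit_fps_square_add by algebra
  finally have E: "E = ?T\<^sup>2 + fps_X * S\<^sup>2" .
  have odd: "odd_part E = S" and even: "even_part E = ?T"
    unfolding E by (rule odd_part_eq even_part_eq)+
  have "E * E\<^sup>2 = (a * b) ^ 3 * (c * d) ^ 3"
    unfolding E_def by algebra
  also have "\<dots> = ((a * c) ^ 6 + fps_X ^ 3 * (b * d) ^ 6)\<^sup>2 + fps_X * (S\<^sup>2)\<^sup>2"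
    unfolding ab cd S_def bit_fps_square_add by algebra
  finally have "odd_part (E * E\<^sup>2) = S\<^sup>2" by (simp only: odd_part_eq)
  hence "S * E = S\<^sup>2" by (simp only: odd_part_mult_square odd)
  moreover have "S $ 0 \<noteq> 0" using nz by (simp add: S_def)
  hence "S \<noteq> 0" by auto
  ultimately show "S = E" by (simp add: power2_eq_square)
  with odd even show "odd_part E = E" "even_part E = ?T" by simp_all
qed

text \<open>Applied with F = ad and G = bc, this supplies the odd part of bc. Dissecting E both as F
  G and as G^3 + X F^3 gives relations among the halves of E, F and G; elimination yields
  \<open>F0 = G + fps_X * F\<^sup>2\<close>, which turns \<open>i\<close> into the claim.\<close>

lemma mult_odd_part_eq:
  fixes F G E :: "bit fps"
  assumes E: "E = F * G" and S: "G ^ 3 + fps_X * F ^ 3 = E" and odd: "odd_part E = E" and nz: "E \<noteq> 0"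
  shows "G * odd_part G = fps_X * F ^ 3"
proof -
  define F0 F1 G0 G1 E0 where "F0 = even_part F" "F1 = odd_part F" "G0 = even_part G" "G1 = odd_part G"
    and "E0 = even_part E"
  have F: "F = F0\<^sup>2 + fps_X * F1\<^sup>2" and Esq: "E = E0\<^sup>2 + fps_X * E\<^sup>2"
    using even_odd_decomposition[of F] even_odd_decomposition[of E] odd
    by (simp_all add: F0_F1_G0_G1_def E0_def)
  have E1: "E = F0 * G1 + F1 * G0"
    using odd odd_part_mult[of F G] by (simp add: E F0_F1_G0_G1_def)
  have E0: "E0 = F0 * G0 + fps_X * (F1 * G1)"
    using even_part_mult[of F G] by (simp add: E F0_F1_G0_G1_def E0_def)
  have cube: "E = G * G\<^sup>2 + fps_X * (F * F\<^sup>2)"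
    using S by (simp add: power3_eq_cube power2_eq_square mult.assoc)
  have "E = G1 * G + F0 * F"
    by (subst odd[symmetric], subst cube)
      (simp add: odd_part_add odd_part_mult_square odd_part_fps_X_mult even_part_mult_square F0_F1_G0_G1_def)
  hence i: "G * G1 = E + F * F0"
    using bit_fps_add_eq_iff[of "G * G1" "F * F0" E] by (simp add: mult.commute)
  have "E0 = G0 * G + fps_X * (F1 * F)"
    unfolding E0_def by (subst cube)
      (simp add: even_part_add even_part_mult_square even_part_fps_X_mult odd_part_mult_square F0_F1_G0_G1_def)
  hence ii: "G * G0 = E0 + fps_X * F * F1"
    using bit_fps_add_eq_iff[of "G * G0" "fps_X * F * F1" E0] by (simp add: mult_ac)
  \<comment> \<open>Multiplying the product dissections \<open>E1\<close> and \<open>E0\<close> by G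
    lets \<open>i\<close> and \<open>ii\<close> eliminate both halves of G.\<close>
  have "E * G = F0 * (G * G1) + F1 * (G * G0)" by (subst E1) algebra
  also have "\<dots> = E * F0 + E0 * F1 + F * (F0\<^sup>2 + fps_X * F1\<^sup>2)"
    unfolding i ii by algebra
  finally have 1: "E * G = E * F0 + E0 * F1 + F * F" by (simp flip: F)
  have "E0 * G = F0 * (G * G0) + fps_X * F1 * (G * G1)" by (subst E0) algebra
  also have "\<dots> = E0 * F0 + fps_X * E * F1 + (fps_X * F * F0 * F1 + fps_X * F * F0 * F1)"
    unfolding i ii by algebra
  finally have 2: "E0 * G = E0 * F0 + fps_X * E * F1" by (simp add: bit_fps_add_self)
  \<comment> \<open>The self-similarity \<open>Esq\<close> combines \<open>1\<close> and
    \<open>2\<close> into one equation divisible by E, in which the cross terms X E E0 F1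
    cancel.\<close>
  have "E * G = (fps_X * E) * (E * G) + E0 * (E0 * G)"
    by (subst (1) Esq) algebra
  also have "\<dots> = (E0\<^sup>2 + fps_X * E\<^sup>2) * F0 + fps_X * E * F\<^sup>2 +
      (fps_X * E * E0 * F1 + fps_X * E * E0 * F1)"
    unfolding 1 2 by algebra
  also have "\<dots> = E * (F0 + fps_X * F\<^sup>2)"
    unfolding bit_fps_add_self Esq[symmetric] by algebra
  finally have "F0 + fps_X * F\<^sup>2 = G" using nz by simp
  hence "F0 = G + fps_X * F\<^sup>2" by (simp add: bit_fps_add_eq_iff)
  hence "G * G1 = fps_X * F ^ 3 + (F * G + F * G)"
    unfolding i E by (simp add: algebra_simps power2_eq_square power3_eq_cube)
  thus ?thesis by (simp add: bit_fps_add_self F0_F1_G0_G1_def)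
qed

text \<open>Before each section both sides are arranged so that the current series stands beside a
  perfect square, which the section passes as its root. In the first, third and fourth sections the
  other side is E or X E times a square, so \<open>odd_E\<close> applies; the second meets bc and
  relies on \<open>bc\<close>.\<close>

lemma sixteenth_section:
  fixes a b c d B :: "bit fps"
  defines "E \<equiv> a * b * c * d"
  assumes B: "B * (a * d * b ^ 8 * c ^ 8 * d ^ 8) = b * c * a ^ 8"
    and odd_E: "odd_part E = E"
    and bc: "b * c * odd_part (b * c) = fps_X * (a * d) ^ 3"
    and nz: "a \<noteq> 0" "b \<noteq> 0" "c \<noteq> 0" "d \<noteq> 0"
  shows "even_part (even_part (odd_part (odd_part B))) = fps_X * a\<^sup>2 * d"
proof -
  \<comment> \<open>The extra factor ad makes the multiplier of B a square and turns bc on the other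
    side into E.\<close>
  have "B * (a * d * b ^ 4 * c ^ 4 * d ^ 4)\<^sup>2 = (B * (a * d * b ^ 8 * c ^ 8 * d ^ 8)) * (a * d)"
    by algebra
  also have "\<dots> = E * (a ^ 4)\<^sup>2" unfolding B E_def by algebra
  finally have "odd_part (B * (a * d * b ^ 4 * c ^ 4 * d ^ 4)\<^sup>2) = odd_part (E * (a ^ 4)\<^sup>2)" by simp
  hence "odd_part B * (a * d * b ^ 4 * c ^ 4 * d ^ 4) = E * a ^ 4"
    by (simp only: odd_part_mult_square odd_E)
  hence "(a * d) * (odd_part B * (b\<^sup>2 * c\<^sup>2 * d\<^sup>2)\<^sup>2) = (a * d) * (b * c * (a\<^sup>2)\<^sup>2)"
    unfolding E_def by algebra
  hence "odd_part (odd_part B * (b\<^sup>2 * c\<^sup>2 * d\<^sup>2)\<^sup>2) = odd_part (b * c * (a\<^sup>2)\<^sup>2)" using nz by simp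
  hence 1: "odd_part (odd_part B) * (b\<^sup>2 * c\<^sup>2 * d\<^sup>2) = odd_part (b * c) * a\<^sup>2"
    by (simp only: odd_part_mult_square)
  \<comment> \<open>Multiplying by (bc)^2 produces bc times its odd part, which \<open>bc\<close>
    evaluates, and again leaves E times a square.\<close>
  have "d\<^sup>2 * (odd_part (odd_part B) * (b\<^sup>2 * c\<^sup>2)\<^sup>2) =
      (odd_part (odd_part B) * (b\<^sup>2 * c\<^sup>2 * d\<^sup>2)) * (b * c) * (b * c)"
    by algebra
  also have "\<dots> = (b * c * odd_part (b * c)) * a\<^sup>2 * (b * c)" unfolding 1 by algebra
  also have "\<dots> = d\<^sup>2 * (fps_X * E * (a\<^sup>2)\<^sup>2)" unfolding bc E_def by algebra
  finally have "odd_part (odd_part B) * (b\<^sup>2 * c\<^sup>2)\<^sup>2 = fps_X * E * (a\<^sup>2)\<^sup>2" using nz by simp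
  hence "even_part (odd_part (odd_part B) * (b\<^sup>2 * c\<^sup>2)\<^sup>2) = even_part (fps_X * E * (a\<^sup>2)\<^sup>2)" by simp
  hence "even_part (odd_part (odd_part B)) * (b\<^sup>2 * c\<^sup>2) = fps_X * E * a\<^sup>2"
    by (simp only: even_part_mult_square even_part_fps_X_mult odd_E)
  hence "even_part (odd_part (odd_part B)) * (b * c)\<^sup>2 = fps_X * E * a\<^sup>2"
    by (simp only: power_mult_distrib)
  hence "even_part (even_part (odd_part (odd_part B)) * (b * c)\<^sup>2) = even_part (fps_X * E * a\<^sup>2)" by simp
  hence "even_part (even_part (odd_part (odd_part B))) * (b * c) = fps_X * E * a"
    by (simp only: even_part_mult_square even_part_fps_X_mult odd_E)
  hence "(b * c) * even_part (even_part (odd_part (odd_part B))) = (b * c) * (fps_X * a\<^sup>2 * d)"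
    unfolding E_def by algebra
  thus ?thesis using nz by simp
qed

section \<open>Euler's pentagonal number theorem\<close>

text \<open>These are the generalized pentagonal numbers, with the sign chosen so that 24
  \<open>pent_exp k\<close> + 1 = (6k + 1)^2, in agreement with \<open>pent\<close>.\<close>

definition pent_exp :: "int \<Rightarrow> nat" where
  "pent_exp k = nat (k * (3 * k + 1) div 2)"

lemma pent_exp_eq: "2 * int (pent_exp k) = k * (3 * k + 1)"
proof -
  have "even (k * (3 * k + 1))" by simp
  moreover have "k * (3 * k + 1) \<ge> 0" by (cases "k \<ge> 0") (auto simp: mult_nonpos_nonpos)
  ultimately show ?thesis by (simp add: pent_exp_def)
qed

lemma abs_le_pent_exp: "\<bar>k\<bar> \<le> int (pent_exp k)"
proof -
  have "\<bar>k\<bar> \<le> k\<^sup>2" "k\<^sup>2 \<ge> 0" by (rule abs_le_square_int) simp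
  moreover have "2 * int (pent_exp k) = 3 * k\<^sup>2 + k"
    unfolding pent_exp_eq by (simp add: power2_eq_square algebra_simps)
  ultimately show ?thesis by linarith
qed

text \<open>Shanks' identity; the terms with \<open>s > 0\<close> on the left have order greater than \<open>n\<close>
  in \<open>q\<close>.\<close>

lemma shanks_identity:
  fixes q :: "'a::comm_ring_1"
  shows "(\<Sum>s\<le>n. (-1) ^ s * (\<Prod>j\<in>{s<..n}. 1 - q ^ j) * q ^ (s * n + (\<Sum>{..s}))) =
         (\<Sum>k\<in>{-int n..int n}. (-1) ^ nat \<bar>k\<bar> * q ^ pent_exp k)"
proof (induction n)
  case 0
  thus ?case by (simp add: pent_exp_def)
next
  case (Suc n)
  define T where "T m s = (\<Prod>j\<in>{s<..m}. 1 - q ^ j)" for m s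
  define t :: "nat \<Rightarrow> nat" where "t s = \<Sum>{..s}" for s
  define A where "A s = (-1) ^ s * T n s * q ^ (s * n + t s)" for s
  define B where "B s = (-1) ^ s * T n s * q ^ (Suc s * Suc n + t s)" for s
  have t: "2 * t s = s * Suc s" "t (Suc s) = t s + Suc s" for s
    by (induction s) (auto simp: t_def)
  have T_Suc: "T (Suc n) s = T n s * (1 - q ^ Suc n)" if "s \<le> n" for s
  proof -
    have "{s<..Suc n} = insert (Suc n) {s<..n}" using that by auto
    thus ?thesis by (simp add: T_def mult.commute)
  qed
  have summand: "(-1) ^ s * T (Suc n) s * q ^ (s * Suc n + t s) = A s * q ^ s - B s" if "s \<le> n" for s
    unfolding T_Suc[OF that] A_def B_def by (simp add: algebra_simps power_add)
  \<comment> \<open>\<open>T n r\<close> contains the factor 1 - q^(r+1), so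
    \<open>A (Suc r) * (q ^ Suc r - 1)\<close> is \<open>B r\<close>. Hence the terms
    \<open>B r\<close> with r < n cancel and only \<open>B n\<close> is left over.\<close>
  have A_Suc: "A (Suc r) * q ^ Suc r = A (Suc r) + B r" if "r < n" for r
  proof -
    have "{r<..n} = insert (Suc r) {Suc r<..n}" using that by auto
    hence T: "T n r = (1 - q ^ Suc r) * T n (Suc r)" by (simp add: T_def)
    show ?thesis unfolding A_def B_def T t by (simp add: algebra_simps power_add)
  qed
  have "(\<Sum>s\<le>n. A s * q ^ s) = A 0 + (\<Sum>r<n. A (Suc r) * q ^ Suc r)"
    by (simp add: sum.atMost_shift)
  also have "\<dots> = (\<Sum>s\<le>n. A s) + (\<Sum>r<n. B r)"
    by (simp add: A_Suc sum.distrib sum.atMost_shift del: power_Suc)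
  finally have "(\<Sum>s\<le>n. A s * q ^ s - B s) = (\<Sum>s\<le>n. A s) - B n"
    by (simp add: sum_subtractf flip: lessThan_Suc_atMost)
  hence left: "(\<Sum>s\<le>Suc n. (-1) ^ s * T (Suc n) s * q ^ (s * Suc n + t s)) =
      (\<Sum>s\<le>n. A s) - B n + (-1) ^ Suc n * T (Suc n) (Suc n) * q ^ (Suc n * Suc n + t (Suc n))"
    by (simp add: summand del: power_Suc mult_Suc mult_Suc_right)
  \<comment> \<open>The two boundary terms, \<open>- B n\<close> and the new summand s = n + 1,
    carry the exponents of k = -(n + 1) and k = n + 1.\<close>
  have exponents: "t n + Suc n * Suc n = pent_exp (- int (Suc n))"
    "t (Suc n) + Suc n * Suc n = pent_exp (int (Suc n))"
  proof -
    have cancel: "a = b" if "2 * int a = 2 * int b" for a b using that by simp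
    have "2 * int (t n + Suc n * Suc n) = 2 * int (pent_exp (- int (Suc n)))"
      "2 * int (t (Suc n) + Suc n * Suc n) = 2 * int (pent_exp (int (Suc n)))"
      using arg_cong[OF t(1)[of n], of int] arg_cong[OF t(1)[of "Suc n"], of int]
      unfolding pent_exp_eq by (simp_all add: algebra_simps)
    thus "t n + Suc n * Suc n = pent_exp (- int (Suc n))"
      "t (Suc n) + Suc n * Suc n = pent_exp (int (Suc n))" by (blast intro: cancel)+
  qed
  have right: "(\<Sum>k\<in>{-int (Suc n)..int (Suc n)}. (-1) ^ nat \<bar>k\<bar> * q ^ pent_exp k) =
      (\<Sum>k\<in>{-int n..int n}. (-1) ^ nat \<bar>k\<bar> * q ^ pent_exp k) +
      (-1) ^ Suc n * (q ^ pent_exp (- int (Suc n)) + q ^ pent_exp (int (Suc n)))"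
  proof -
    have "{-int (Suc n)..int (Suc n)} = insert (- int (Suc n)) (insert (int (Suc n)) {-int n..int n})"
      by auto
    moreover have "nat \<bar>- int (Suc n)\<bar> = Suc n" "nat \<bar>int (Suc n)\<bar> = Suc n" by auto
    ultimately show ?thesis by (simp del: of_nat_Suc power_Suc add: algebra_simps)
  qed
  have IH: "(\<Sum>s\<le>n. A s) = (\<Sum>k\<in>{-int n..int n}. (-1) ^ nat \<bar>k\<bar> * q ^ pent_exp k)"
    unfolding A_def T_def t_def by (rule Suc.IH)
  have "B n = (-1) ^ n * q ^ pent_exp (- int (Suc n))"
    "(-1) ^ Suc n * T (Suc n) (Suc n) * q ^ (Suc n * Suc n + t (Suc n)) =
      (-1) ^ Suc n * q ^ pent_exp (int (Suc n))"
    unfolding exponents[symmetric]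
    by (simp_all add: B_def T_def add.commute del: mult_Suc mult_Suc_right power_Suc)
  hence "(\<Sum>s\<le>Suc n. (-1) ^ s * T (Suc n) s * q ^ (s * Suc n + t s)) =
      (\<Sum>k\<in>{-int (Suc n)..int (Suc n)}. (-1) ^ nat \<bar>k\<bar> * q ^ pent_exp k)"
    unfolding left right IH by (simp add: algebra_simps)
  thus ?case by (simp only: T_def t_def)
qed

text \<open>This is Shanks' identity at q = X^i and length M, where the term s = 0 is the truncated
  product itself.\<close>

lemma prod_one_minus_fps_X_power_nth:
  assumes "i > 0" "n \<le> M"
  shows "(\<Prod>m<M. 1 - fps_X ^ (i * Suc m) :: 'a::comm_ring_1 fps) $ n =
           (\<Sum>k\<in>{-int M..int M}. if i * pent_exp k = n then (-1) ^ nat \<bar>k\<bar> else 0)"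
proof -
  let ?q = "fps_X ^ i :: 'a fps"
  let ?f = "\<lambda>s. (-1) ^ s * (\<Prod>j\<in>{s<..M}. 1 - ?q ^ j) * ?q ^ (s * M + (\<Sum>{..s}))"
  have "?f s $ n = 0" if "s \<noteq> 0" for s
  proof -
    have "M \<le> s * M" "s \<in> {..s}" using that by auto
    moreover have "s \<le> \<Sum>{..s}" by (rule member_le_sum) auto
    ultimately have "n < s * M + \<Sum>{..s}" using assms(2) that by linarith
    also have "\<dots> \<le> i * \<dots>" using assms(1) by simp
    finally show ?thesis by (simp add: fps_X_power_mult_right_nth flip: power_mult)
  qed
  hence "(\<Sum>s\<le>M. ?f s) $ n = ?f 0 $ n"
    unfolding fps_sum_nth by (subst sum.remove[of _ 0]) auto
  also have "?f 0 = (\<Prod>m<M. 1 - fps_X ^ (i * Suc m))"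
  proof -
    have "(\<Prod>m<M. 1 - ?q ^ Suc m) = (\<Prod>j\<in>{0<..M}. 1 - ?q ^ j)"
      by (rule prod.reindex_bij_witness[of _ "\<lambda>j. j - 1" Suc]) auto
    thus ?thesis by (simp add: power_mult del: power_Suc mult_Suc_right)
  qed
  finally have "(\<Prod>m<M. 1 - fps_X ^ (i * Suc m) :: 'a fps) $ n = (\<Sum>s\<le>M. ?f s) $ n" ..
  also have "\<dots> = (\<Sum>k\<in>{-int M..int M}. ((-1) ^ nat \<bar>k\<bar> * ?q ^ pent_exp k) $ n)"
    unfolding shanks_identity by (rule fps_sum_nth)
  also have "\<dots> = (\<Sum>k\<in>{-int M..int M}. if i * pent_exp k = n then (-1) ^ nat \<bar>k\<bar> else 0)"
  proof (rule sum.cong)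
    fix k
    have "(-1) ^ nat \<bar>k\<bar> = fps_const ((-1 :: 'a) ^ nat \<bar>k\<bar>)"
      by (metis fps_const_1_eq_1 fps_const_neg fps_const_power)
    thus "((-1) ^ nat \<bar>k\<bar> * ?q ^ pent_exp k) $ n =
        (if i * pent_exp k = n then (-1) ^ nat \<bar>k\<bar> else 0)"
      unfolding power_mult[symmetric]
      by (simp only: fps_mult_left_const_nth fps_X_power_nth) simp
  qed simp
  finally show ?thesis .
qed

section \<open>The generating function modulo 2\<close>

lemma pent_exp_bound:
  assumes "i > 0" "i * pent_exp k = n"
  shows "k \<in> {-int n..int n}"
proof -
  have "pent_exp k \<le> i * pent_exp k" using assms(1) by simp
  hence "\<bar>k\<bar> \<le> int n" using abs_le_pent_exp[of k] unfolding assms(2) by linarith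
  thus ?thesis by auto
qed

text \<open>For i > 0 this is the coefficient of q^n in f_i; by \<open>pent_exp_bound\<close> the
  finite range of k misses no solution.\<close>

definition pent_coeff :: "nat \<Rightarrow> nat \<Rightarrow> int" where
  "pent_coeff i n = (\<Sum>k\<in>{-int n..int n}. if i * pent_exp k = n then (-1) ^ nat \<bar>k\<bar> else 0)"

lemma prod_one_minus_fps_X_power_nth_stable:
  assumes "i > 0" "n \<le> M"
  shows "(\<Prod>m<M. 1 - fps_X ^ (i * Suc m) :: 'a::comm_ring_1 fps) $ n = of_int (pent_coeff i n)"
proof -
  have "(\<Sum>k\<in>{-int M..int M}. if i * pent_exp k = n then (-1) ^ nat \<bar>k\<bar> else (0::'a)) =
      (\<Sum>k\<in>{-int n..int n}. if i * pent_exp k = n then (-1) ^ nat \<bar>k\<bar> else 0)"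
    using assms(2) pent_exp_bound[OF assms(1)] by (intro sum.mono_neutral_right) auto
  also have "\<dots> = of_int (pent_coeff i n)"
    unfolding pent_coeff_def of_int_sum by (intro sum.cong) auto
  finally show ?thesis
    unfolding prod_one_minus_fps_X_power_nth[OF assms] .
qed

text \<open>The truncated products converge uniformly near 0, so their Taylor coefficients converge,
  and each coefficient is eventually constant.\<close>

lemma fps_expansion_euler_f_nth:
  assumes "i > 0"
  shows "fps_expansion (euler_f i) 0 $ n = of_int (pent_coeff i n)"
proof -
  let ?P = "\<lambda>M q. \<Prod>m<M. 1 - (q::complex) ^ (i * Suc m)"
  have "uniform_limit (ball 0 (1/2)) ?P (euler_f i) sequentially"
    by (rule uniform_limit_on_subset[OF uniform_limit_euler_f[OF assms, of "1/2"]]) auto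
  hence "(\<lambda>M. (deriv ^^ n) (?P M) 0) \<longlonglongrightarrow> (deriv ^^ n) (euler_f i) 0"
    by (rule higher_deriv_complex_uniform_limit)
       (auto intro!: always_eventually holomorphic_intros)
  hence "(\<lambda>M. (deriv ^^ n) (?P M) 0 / fact n) \<longlonglongrightarrow> (deriv ^^ n) (euler_f i) 0 / fact n"
    by (intro tendsto_intros) auto
  hence "(\<lambda>M. fps_expansion (?P M) 0 $ n) \<longlonglongrightarrow> fps_expansion (euler_f i) 0 $ n"
    by (simp add: fps_expansion_def)
  moreover have "eventually (\<lambda>M. fps_expansion (?P M) 0 $ n = of_int (pent_coeff i n)) sequentially"
    using eventually_ge_at_top[of n]
  proof eventually_elim
    case (elim M)
    have "?P M has_fps_expansion (\<Prod>m<M. 1 - fps_X ^ (i * Suc m))"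
      by (intro fps_expansion_intros)
    hence "fps_expansion (?P M) 0 = (\<Prod>m<M. 1 - fps_X ^ (i * Suc m))"
      by (rule fps_expansion_eqI)
    thus ?case using prod_one_minus_fps_X_power_nth_stable[OF assms elim] by simp
  qed
  hence "(\<lambda>M. fps_expansion (?P M) 0 $ n) \<longlonglongrightarrow> of_int (pent_coeff i n)"
    by (rule tendsto_eventually)
  ultimately show ?thesis by (rule LIMSEQ_unique)
qed

text \<open>One polymorphic map serves twice: injectively into complex series, to import analytic
  identities, and into series over \<open>bit\<close>, as reduction modulo 2.\<close>

definition fps_of_int :: "int fps \<Rightarrow> 'a::comm_ring_1 fps" where
  "fps_of_int F = Abs_fps (\<lambda>n. of_int (F $ n))"

lemma fps_of_int_mult: "fps_of_int (F * G) = fps_of_int F * fps_of_int G"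
  by (rule fps_ext) (simp add: fps_of_int_def fps_mult_nth)

lemma inj_fps_of_int: "inj (fps_of_int :: int fps \<Rightarrow> complex fps)"
  by (rule injI) (simp add: fps_of_int_def fps_eq_iff)

definition euler_fps :: "nat \<Rightarrow> int fps" where
  "euler_fps i = Abs_fps (pent_coeff i)"

lemma euler_f_has_fps_expansion:
  assumes "i > 0"
  shows "euler_f i has_fps_expansion fps_of_int (euler_fps i)"
proof -
  have "euler_f i has_fps_expansion fps_expansion (euler_f i) 0"
    using int_coeffs_euler_f[OF assms] by (intro holomorphic_has_fps_expansion) (simp add: int_coeffs_def)
  also have "fps_expansion (euler_f i) 0 = fps_of_int (euler_fps i)"
    by (rule fps_ext) (simp add: fps_expansion_euler_f_nth[OF assms] fps_of_int_def euler_fps_def)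
  finally show ?thesis .
qed

lemma b_gen_fun_has_fps_expansion:
  assumes "l > 0" "k > 0" "r > 0"
  shows "b_gen_fun l k r has_fps_expansion fps_of_int (Abs_fps (b_coeff l k r))"
proof -
  let ?g = "b_gen_fun l k r"
  have hol: "?g holomorphic_on ball 0 1" and "\<forall>n. \<exists>z. fps_expansion ?g 0 $ n = of_int z"
    using int_coeffs_b_gen_fun[OF assms] by (auto simp: int_coeffs_def elim!: Ints_cases)
  then obtain c where c: "\<And>n. fps_expansion ?g 0 $ n = of_int (c n)" by metis
  have "(\<lambda>n. of_int (c n) * q ^ n) sums ?g q" if "norm q < 1" for q :: complex
  proof -
    have "(\<lambda>n. (deriv ^^ n) ?g 0 / fact n * (q - 0) ^ n) sums ?g q"
      using that by (intro holomorphic_power_series[OF hol]) auto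
    thus ?thesis by (simp add: c[symmetric] fps_expansion_def)
  qed
  hence "b_coeff l k r = c"
    unfolding b_coeff_def by (intro the1_equality[OF b_coeff_ex1[OF assms]]) auto
  hence "fps_of_int (Abs_fps (b_coeff l k r)) = fps_expansion ?g 0"
    by (intro fps_ext) (simp add: fps_of_int_def c)
  thus ?thesis using holomorphic_has_fps_expansion[OF hol] by simp
qed

text \<open>Functions that agree near 0 have equal complex expansions, and injectivity of
  \<open>fps_of_int\<close> brings the identity back to integer series. With the denominators
  cleared it can then be reduced modulo 2.\<close>

lemma b_coeff_fps_eq:
  assumes "l > 0" "k > 0" "r > 0"
  shows "Abs_fps (b_coeff l k r) * (euler_fps 1 * euler_fps (l * k) * euler_fps (l * r) *
           euler_fps (k * r) * euler_fps (l * k * r)) = euler_fps l * euler_fps k * euler_fps r"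
    (is "?B * ?D = ?N")
proof -
  let ?d = "\<lambda>q. euler_f 1 q * euler_f (l * k) q * euler_f (l * r) q *
      euler_f (k * r) q * euler_f (l * k * r) q"
  let ?n = "\<lambda>q. euler_f l q * euler_f k q * euler_f r q"
  have "(\<lambda>q. b_gen_fun l k r q * ?d q) has_fps_expansion fps_of_int (?B * ?D)"
    unfolding fps_of_int_mult using assms
    by (intro has_fps_expansion_mult b_gen_fun_has_fps_expansion euler_f_has_fps_expansion) auto
  moreover have ev: "eventually (\<lambda>q. b_gen_fun l k r q * ?d q = ?n q) (nhds 0)"
    using eventually_nhds_in_open[of "ball 0 1" "0::complex"]
  proof (rule eventually_mono)
    fix q :: complex assume "q \<in> ball 0 1"
    hence "?d q \<noteq> 0" using assms euler_f_nonzero[of _ q] by simp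
    thus "b_gen_fun l k r q * ?d q = ?n q" by (simp add: b_gen_fun_def)
  qed auto
  ultimately have "?n has_fps_expansion fps_of_int (?B * ?D)"
    using has_fps_expansion_cong[OF ev refl] by blast
  moreover have "?n has_fps_expansion fps_of_int ?N"
    unfolding fps_of_int_mult using assms by (intro has_fps_expansion_mult euler_f_has_fps_expansion)
  ultimately have "fps_of_int (?B * ?D) = (fps_of_int ?N :: complex fps)"
    by (rule fps_expansion_unique_complex)
  thus ?thesis by (rule injD[OF inj_fps_of_int])
qed

lemma pent_compose_nth:
  assumes "i > 0"
  shows "(pent oo fps_X ^ i) $ n = of_nat (card {x. x mod 6 = 1 \<and> int i * (x\<^sup>2 - 1) = 24 * int n})"
  unfolding pent_def
proof (subst theta_square_compose_nth)
  fix x :: int assume "x \<in> {x. x mod 6 = 1}"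
  hence "x mod 6 = 1" by simp
  hence "odd x" "x mod 3 \<noteq> 0" by presburger+
  thus "24 dvd x\<^sup>2 - 1" by (rule dvd_square_minus_one_24)
qed (use assms in auto)

text \<open>Modulo 2 the signs disappear, and x = 6k + 1 completes the square.\<close>

lemma fps_of_int_euler_fps_bit:
  assumes "i > 0"
  shows "(fps_of_int (euler_fps i) :: bit fps) = pent oo fps_X ^ i"
proof (rule fps_ext)
  fix n
  let ?K = "{k \<in> {-int n..int n}. i * pent_exp k = n}"
  have "of_int (pent_coeff i n) = (\<Sum>k\<in>{-int n..int n}. if i * pent_exp k = n then 1 else (0::bit))"
    unfolding pent_coeff_def of_int_sum by (intro sum.cong) auto
  also have "\<dots> = of_nat (card ?K)"
    by (simp add: sum.If_cases Int_def)
  also have "card ?K = card {x. x mod 6 = 1 \<and> int i * (x\<^sup>2 - 1) = 24 * int n}"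
  proof (rule bij_betw_same_card)
    have iff: "int i * ((6 * k + 1)\<^sup>2 - 1) = 24 * int n \<longleftrightarrow> i * pent_exp k = n" for k
    proof -
      have "int i * ((6 * k + 1)\<^sup>2 - 1) = 24 * int (i * pent_exp k)"
      proof -
        have "(6 * k + 1)\<^sup>2 - 1 = 12 * (2 * int (pent_exp k))"
          unfolding pent_exp_eq by (simp add: power2_eq_square algebra_simps)
        thus ?thesis by simp
      qed
      thus ?thesis by (simp del: of_nat_mult)
    qed
    show "bij_betw (\<lambda>k. 6 * k + 1) ?K {x. x mod 6 = 1 \<and> int i * (x\<^sup>2 - 1) = 24 * int n}"
    proof (rule bij_betwI')
      fix x assume x: "x \<in> {x. x mod 6 = 1 \<and> int i * (x\<^sup>2 - 1) = 24 * int n}"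
      hence "x = 6 * (x div 6) + 1" using mult_div_mod_eq[of 6 x] by simp
      with x show "\<exists>k\<in>?K. x = 6 * k + 1"
        using iff[of "x div 6"] pent_exp_bound[OF assms] by (intro bexI[of _ "x div 6"]) auto
    next
      fix k assume "k \<in> ?K"
      hence "i * pent_exp k = n" by simp
      moreover have "(6 * k + 1) mod 6 = 1" by simp
      ultimately show "6 * k + 1 \<in> {x. x mod 6 = 1 \<and> int i * (x\<^sup>2 - 1) = 24 * int n}"
        using iff by blast
    qed simp
  qed
  finally show "(fps_of_int (euler_fps i) :: bit fps) $ n = (pent oo fps_X ^ i) $ n"
    by (simp add: pent_compose_nth[OF assms] fps_of_int_def euler_fps_def)
qed

lemma compose_fps_X_power_compose:
  assumes "j > 0"
  shows "(F oo fps_X ^ i) oo fps_X ^ j = F oo fps_X ^ (i * j)"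
proof (rule fps_ext)
  fix n
  show "((F oo fps_X ^ i) oo fps_X ^ j) $ n = (F oo fps_X ^ (i * j)) $ n"
  proof (cases "j dvd n")
    case True
    then obtain m where "n = j * m" by (rule dvdE)
    thus ?thesis using assms by (simp add: fps_nth_compose_X_power mult.commute[of i j])
  next
    case False
    hence "\<not> i * j dvd n" using dvd_mult_right by blast
    thus ?thesis using False by (simp add: fps_nth_compose_X_power)
  qed
qed

lemma bit_fps_compose_double: "(F :: bit fps) oo fps_X ^ (2 * i) = (F oo fps_X ^ i)\<^sup>2"
proof -
  have "F oo fps_X ^ (i * 2) = (F oo fps_X ^ i)\<^sup>2"
    unfolding compose_fps_X_power_compose[of 2, symmetric, OF zero_less_numeral]
    by (rule fps_ext) (simp only: fps_nth_compose_X_power bit_fps_square_nth)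
  thus ?thesis by (simp only: mult.commute)
qed

section \<open>Relations between the Euler products modulo 2\<close>

definition euler_bit :: "nat \<Rightarrow> bit fps" where
  "euler_bit i = pent oo fps_X ^ i"

lemma euler_bit_double: "euler_bit (2 * i) = (euler_bit i)\<^sup>2"
  by (simp add: euler_bit_def bit_fps_compose_double)

lemma euler_bit_compose: "j > 0 \<Longrightarrow> euler_bit i oo fps_X ^ j = euler_bit (i * j)"
  by (simp add: euler_bit_def compose_fps_X_power_compose)

lemma euler_bit_1: "euler_bit 1 = pent"
  by (simp add: euler_bit_def)

lemma euler_bit_nth_0: "euler_bit i $ 0 = 1"
proof -
  have "{x::int. x mod 6 = 1 \<and> x\<^sup>2 = 1} = {1}" by (auto simp: power2_eq_1_iff)
  hence "pent $ 0 = 1" using pent_compose_nth[of 1 0] by simp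
  thus ?thesis by (simp add: euler_bit_def)
qed

text \<open>This is Jacobi's identity modulo 2, obtained by cancelling f_1 from f_1 psi = f_4 =
  f_1^4.\<close>

lemma psi_eq: "psi = euler_bit 1 ^ 3"
proof -
  have "euler_bit 1 * psi = euler_bit (2 * (2 * 1))" using pent_times_psi by (simp add: euler_bit_def)
  also have "\<dots> = euler_bit 1 * euler_bit 1 ^ 3" unfolding euler_bit_double by algebra
  finally show ?thesis using euler_bit_nth_0[of 1] by auto
qed

lemma psi_compose: "i > 0 \<Longrightarrow> psi oo fps_X ^ i = euler_bit i ^ 3"
  unfolding psi_eq by (subst fps_compose_power[symmetric]) (simp_all add: euler_bit_compose)

text \<open>The cases i = 1 and i = 3 are the relations for ac and bd.\<close>

lemma euler_bit_mult_5:
  assumes "i > 0"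
  shows "euler_bit i * euler_bit (5 * i) = euler_bit i ^ 6 + fps_X ^ i * euler_bit (5 * i) ^ 6"
proof -
  have "euler_bit 1 * euler_bit 5 = euler_bit (2 * 1) ^ 3 + fps_X * euler_bit (2 * 5) ^ 3"
    using pent_times_pent_5 unfolding euler_bit_1 by (simp add: psi_compose euler_bit_def[of 5])
  also have "\<dots> = euler_bit 1 ^ 6 + fps_X * euler_bit 5 ^ 6"
    unfolding euler_bit_double by algebra
  finally have "(euler_bit 1 * euler_bit 5) oo fps_X ^ i =
      (euler_bit 1 ^ 6 + fps_X * euler_bit 5 ^ 6) oo fps_X ^ i" by simp
  moreover have "(fps_X ^ i :: bit fps) $ 0 = 0" using assms by simp
  ultimately show ?thesis
    using assms
    by (simp only: fps_compose_mult_distrib fps_compose_add_distrib fps_compose_power[symmetric]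
        euler_bit_compose fps_X_fps_compose_startby0 mult_1)
qed

text \<open>The cases i = 1 and i = 5 are the relations for (ab)^3 and (cd)^3.\<close>

lemma euler_bit_mult_3_cubed:
  assumes "i > 0"
  shows "(euler_bit i * euler_bit (3 * i)) ^ 3 = euler_bit i ^ 12 + fps_X ^ i * euler_bit (3 * i) ^ 12"
proof -
  have "(euler_bit 1 * euler_bit 3) ^ 3 = psi * (psi oo fps_X ^ 3)"
    by (simp only: psi_compose[OF zero_less_numeral]) (simp only: psi_eq power_mult_distrib)
  also have "\<dots> = euler_bit (2 * (2 * 1)) ^ 3 + fps_X * euler_bit (2 * (2 * 3)) ^ 3"
    unfolding psi_times_psi_3 by (simp add: psi_compose)
  also have "\<dots> = euler_bit 1 ^ 12 + fps_X * euler_bit 3 ^ 12"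
    unfolding euler_bit_double by algebra
  finally have "((euler_bit 1 * euler_bit 3) ^ 3) oo fps_X ^ i =
      (euler_bit 1 ^ 12 + fps_X * euler_bit 3 ^ 12) oo fps_X ^ i" by simp
  moreover have "(fps_X ^ i :: bit fps) $ 0 = 0" using assms by simp
  ultimately show ?thesis
    using assms
    by (simp only: fps_compose_mult_distrib fps_compose_add_distrib fps_compose_power[symmetric]
        euler_bit_compose fps_X_fps_compose_startby0 mult_1)
qed

lemma b_coeff_sixteenth_section:
  "Abs_fps (\<lambda>n. of_int (b_coeff 3 5 8 (16 * n + 3))) = fps_X * (euler_bit 2 * euler_bit 15)"
proof -
  define B :: "bit fps" where "B = fps_of_int (Abs_fps (b_coeff 3 5 8))"
  have nz: "euler_bit i \<noteq> 0" for i using euler_bit_nth_0[of i] by auto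
  have "fps_of_int (Abs_fps (b_coeff 3 5 8) * (euler_fps 1 * euler_fps (3 * 5) * euler_fps (3 * 8) *
           euler_fps (5 * 8) * euler_fps (3 * 5 * 8))) =
        (fps_of_int (euler_fps 3 * euler_fps 5 * euler_fps 8) :: bit fps)"
    by (subst b_coeff_fps_eq) simp_all
  \<comment> \<open>The indices 24, 40, 120 and 8 are written as triple doublings, so that
    \<open>euler_bit_double\<close> yields eighth powers.\<close>
  hence "B * (euler_bit 1 * euler_bit 15 * euler_bit (2 * (2 * (2 * 3))) *
        euler_bit (2 * (2 * (2 * 5))) * euler_bit (2 * (2 * (2 * 15)))) =
      euler_bit 3 * euler_bit 5 * euler_bit (2 * (2 * (2 * 1)))"
    by (simp add: B_def fps_of_int_mult fps_of_int_euler_fps_bit euler_bit_def)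
  hence B: "B * (euler_bit 1 * euler_bit 15 * euler_bit 3 ^ 8 * euler_bit 5 ^ 8 * euler_bit 15 ^ 8) =
      euler_bit 3 * euler_bit 5 * euler_bit 1 ^ 8"
    unfolding euler_bit_double by (simp flip: power_mult)
  have "euler_bit 1 * euler_bit 5 = euler_bit 1 ^ 6 + fps_X * euler_bit 5 ^ 6"
    "euler_bit 3 * euler_bit 15 = euler_bit 3 ^ 6 + fps_X ^ 3 * euler_bit 15 ^ 6"
    "(euler_bit 1 * euler_bit 3) ^ 3 = euler_bit 1 ^ 12 + fps_X * euler_bit 3 ^ 12"
    "(euler_bit 5 * euler_bit 15) ^ 3 = euler_bit 5 ^ 12 + fps_X ^ 5 * euler_bit 15 ^ 12"
    using euler_bit_mult_5[of 1] euler_bit_mult_5[of 3]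
      euler_bit_mult_3_cubed[of 1] euler_bit_mult_3_cubed[of 5] by simp_all
  note E = odd_part_euler_product[OF this, unfolded euler_bit_nth_0, OF one_neq_zero one_neq_zero]
  have bc: "euler_bit 3 * euler_bit 5 * odd_part (euler_bit 3 * euler_bit 5) =
      fps_X * (euler_bit 1 * euler_bit 15) ^ 3"
  proof (rule mult_odd_part_eq)
    show "euler_bit 1 * euler_bit 3 * euler_bit 5 * euler_bit 15 =
        (euler_bit 1 * euler_bit 15) * (euler_bit 3 * euler_bit 5)" by (simp only: mult_ac)
  qed (use E nz in auto)
  have "even_part (even_part (odd_part (odd_part B))) = fps_X * (euler_bit 1)\<^sup>2 * euler_bit 15"
    by (rule sixteenth_section[OF B E(2) bc nz nz nz nz])
  also have "even_part (even_part (odd_part (odd_part B))) =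
      Abs_fps (\<lambda>n. of_int (b_coeff 3 5 8 (16 * n + 3)))"
  proof (rule fps_ext)
    \<comment> \<open>The innermost part is the outermost index map: two odd steps contribute 1 + 2,
      two even steps only scale.\<close>
    have "2 * (2 * (2 * (2 * n)) + 1) + 1 = 16 * n + 3" for n :: nat by simp
    thus "even_part (even_part (odd_part (odd_part B))) $ n =
        Abs_fps (\<lambda>n. of_int (b_coeff 3 5 8 (16 * n + 3))) $ n" for n
      by (simp only: even_part_def odd_part_def B_def fps_of_int_def fps_nth_Abs_fps)
  qed
  also have "fps_X * (euler_bit 1)\<^sup>2 * euler_bit 15 = fps_X * (euler_bit 2 * euler_bit 15)"
    using euler_bit_double[of 1] by (simp add: mult.assoc)
  finally show ?thesis .
qed

section \<open>The forms 2x^2 + 15y^2 and 10x^2 + 3y^2 modulo 5\<close>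

definition reps :: "int \<Rightarrow> int \<Rightarrow> int \<Rightarrow> (int \<times> int) set" where
  "reps a b N = {(x, y). x mod 6 = 1 \<and> y mod 6 = 1 \<and> a * x\<^sup>2 + b * y\<^sup>2 = N}"

text \<open>The factor X in the section shifts the index to \<open>Suc m\<close>, and 17 = 2 + 15
  collects the constants -1 of the two weights.\<close>

lemma even_b_coeff_iff_reps:
  "even (b_coeff 3 5 8 (16 * Suc m + 3)) \<longleftrightarrow> even (card (reps 2 15 (24 * int m + 17)))"
proof -
  have dvd: "24 dvd x\<^sup>2 - 1" if "x mod 6 = 1" for x :: int
  proof (rule dvd_square_minus_one_24)
    show "odd x" "x mod 3 \<noteq> 0" using that by presburger+
  qed
  have "(of_int (b_coeff 3 5 8 (16 * Suc m + 3)) :: bit) =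
      Abs_fps (\<lambda>n. of_int (b_coeff 3 5 8 (16 * n + 3))) $ Suc m"
    by simp
  also have "\<dots> = (euler_bit 2 * euler_bit 15) $ m"
    unfolding b_coeff_sixteenth_section by simp
  also have "\<dots> = of_nat (card {(x, y). x \<in> {x. x mod 6 = 1} \<and> y \<in> {x. x mod 6 = 1} \<and>
      int 2 * 24 * (x\<^sup>2 - 1) + int 15 * 24 * (y\<^sup>2 - 1) = 24 * 24 * int m})"
    unfolding euler_bit_def pent_def by (rule theta_square_mult_nth) (use dvd in auto)
  also have "{(x, y). x \<in> {x. x mod 6 = 1} \<and> y \<in> {x. x mod 6 = 1} \<and>
      int 2 * 24 * (x\<^sup>2 - 1) + int 15 * 24 * (y\<^sup>2 - 1) = 24 * 24 * int m} = reps 2 15 (24 * int m + 17)"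
    unfolding reps_def by auto
  finally have "(of_int (b_coeff 3 5 8 (16 * Suc m + 3)) :: bit) = 0 \<longleftrightarrow>
      (of_int (int (card (reps 2 15 (24 * int m + 17)))) :: bit) = 0"
    by (simp only: of_int_of_nat_eq)
  thus ?thesis unfolding of_int_bit_eq_0_iff by simp
qed

lemma square_mod_5: "(x::int)\<^sup>2 mod 5 \<in> {0, 1, 4}"
proof -
  have "x mod 5 = 0 \<or> x mod 5 = 1 \<or> x mod 5 = 2 \<or> x mod 5 = 3 \<or> x mod 5 = 4" by presburger
  moreover have "x\<^sup>2 mod 5 = (x mod 5)\<^sup>2 mod 5" by (rule power_mod[symmetric])
  ultimately show ?thesis by auto
qed

lemma five_dvd_if_dvd_mult_square:
  assumes "5 dvd a * x\<^sup>2" "\<not> 5 dvd a"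
  shows "5 dvd (x::int)"
proof -
  have prime: "prime (5::int)" by simp
  with assms have "5 dvd x\<^sup>2" using prime_dvd_multD by blast
  thus ?thesis by (rule prime_dvd_power[OF prime])
qed

text \<open>Here u stands for a square. As 2 and 3 are nonresidues modulo 5, a u is 0 or a
  nonresidue, whereas 1 and 4 are residues.\<close>

lemma five_mult_plus_ne:
  fixes u v :: int
  assumes "a \<in> {2, 3}" "r \<in> {1, 4}" "u mod 5 \<in> {0, 1, 4}"
  shows "a * u + 5 * v \<noteq> 5 * k + r"
proof
  assume eq: "a * u + 5 * v = 5 * k + r"
  define m where "m = u mod 5"
  have "a * u = 5 * (a * (u div 5)) + a * m"
    unfolding m_def by (metis distrib_left mult.left_commute mult_div_mod_eq)
  hence "a * m - r = 5 * (k - v - a * (u div 5))" using eq by simp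
  hence "5 dvd a * m - r" by (rule dvdI)
  thus False using assms unfolding m_def by auto
qed

lemma reps_2_15_empty: "r \<in> {1, 4} \<Longrightarrow> reps 2 15 (5 * k + r) = {}"
  using five_mult_plus_ne[of 2 r _ "3 * _" k] square_mod_5 by (auto simp: reps_def)

lemma reps_10_3_empty: "r \<in> {1, 4} \<Longrightarrow> reps 10 3 (5 * k + r) = {}"
  using five_mult_plus_ne[of 3 r _ "2 * _" k] square_mod_5 by (auto simp: reps_def add.commute)

text \<open>Scaling by -5 instead of 5 keeps the class of 1 modulo 6.\<close>

lemma minus_5_mult_mod_6: "- (5 * x) mod 6 = x mod (6::int)"
proof -
  have "- (5 * x) = x + 6 * (- x)" by simp
  thus ?thesis by (simp only: mod_mult_self2)
qed

text \<open>Every solution has 5 dividing x; substituting x = -5z and dividing by 5 exchanges the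
  two forms. In \<open>card_reps_10_3\<close> the same happens with y.\<close>

lemma card_reps_2_15: "card (reps 2 15 (5 * N)) = card (reps 10 3 N)"
proof -
  have "(\<lambda>(x, y). (- (5 * x), y)) ` reps 10 3 N = reps 2 15 (5 * N)"
  proof (intro equalityI subsetI)
    fix v assume "v \<in> reps 2 15 (5 * N)"
    then obtain x y where v: "v = (x, y)" "x mod 6 = 1" "y mod 6 = 1" "2 * x\<^sup>2 + 15 * y\<^sup>2 = 5 * N"
      by (auto simp: reps_def)
    have "2 * x\<^sup>2 = 5 * (N - 3 * y\<^sup>2)" using v(4) by simp
    hence "5 dvd x" using five_dvd_if_dvd_mult_square[of 2 x] by simp
    then obtain z where "x = 5 * z" by (rule dvdE)
    hence z: "x = - (5 * (- z))" by simp
    have "(- z, y) \<in> reps 10 3 N"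
      using v minus_5_mult_mod_6[of "- z"] z by (simp add: reps_def power_mult_distrib)
    thus "v \<in> (\<lambda>(x, y). (- (5 * x), y)) ` reps 10 3 N"
      using v(1) z by force
  qed (auto simp: reps_def minus_5_mult_mod_6 power_mult_distrib)
  moreover have "inj_on (\<lambda>(x, y). (- (5 * x), y)) (reps 10 3 N)" by (auto simp: inj_on_def)
  ultimately show ?thesis using card_image by metis
qed

lemma card_reps_10_3: "card (reps 10 3 (5 * N)) = card (reps 2 15 N)"
proof -
  have "(\<lambda>(x, y). (x, - (5 * y))) ` reps 2 15 N = reps 10 3 (5 * N)"
  proof (intro equalityI subsetI)
    fix v assume "v \<in> reps 10 3 (5 * N)"
    then obtain x y where v: "v = (x, y)" "x mod 6 = 1" "y mod 6 = 1" "10 * x\<^sup>2 + 3 * y\<^sup>2 = 5 * N"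
      by (auto simp: reps_def)
    have "3 * y\<^sup>2 = 5 * (N - 2 * x\<^sup>2)" using v(4) by simp
    hence "5 dvd y" using five_dvd_if_dvd_mult_square[of 3 y] by simp
    then obtain z where "y = 5 * z" by (rule dvdE)
    hence z: "y = - (5 * (- z))" by simp
    have "(x, - z) \<in> reps 2 15 N"
      using v minus_5_mult_mod_6[of "- z"] z by (simp add: reps_def power_mult_distrib)
    thus "v \<in> (\<lambda>(x, y). (x, - (5 * y))) ` reps 2 15 N"
      using v(1) z by force
  qed (auto simp: reps_def minus_5_mult_mod_6 power_mult_distrib)
  moreover have "inj_on (\<lambda>(x, y). (x, - (5 * y))) (reps 2 15 N)" by (auto simp: inj_on_def)
  ultimately show ?thesis using card_image by metis
qed

text \<open>On this progression the represented number is divisible by 5, and removing the factor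
  swaps the forms. One more such step, in \<open>even_b_coeff_400\<close>, swaps them back.\<close>

lemma even_b_coeff_80: "even (b_coeff 3 5 8 (80 * n + 51)) \<longleftrightarrow> even (card (reps 10 3 (24 * int n + 13)))"
proof -
  have "80 * n + 51 = 16 * Suc (5 * n + 2) + 3" by simp
  moreover have "24 * int (5 * n + 2) + 17 = 5 * (24 * int n + 13)" by simp
  ultimately show ?thesis using even_b_coeff_iff_reps card_reps_2_15 by metis
qed

lemma even_b_coeff_400: "even (b_coeff 3 5 8 (400 * n + 291)) \<longleftrightarrow> even (card (reps 2 15 (24 * int n + 17)))"
proof -
  have "400 * n + 291 = 80 * (5 * n + 3) + 51" by simp
  moreover have "24 * int (5 * n + 3) + 13 = 5 * (24 * int n + 17)" by simp
  ultimately show ?thesis using even_b_coeff_80 card_reps_10_3 by metis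
qed

lemma reps_2_15_residues:
  assumes "j \<in> {1, 3}"
  shows "reps 2 15 (24 * int (5 * n + j) + 17) = {}"
proof -
  have "24 * int (5 * n + j) + 17 = 5 * (24 * int n + 8) + 1 \<or>
        24 * int (5 * n + j) + 17 = 5 * (24 * int n + 17) + 4"
    using assms by auto
  thus ?thesis by (elim disjE) (simp_all only: reps_2_15_empty insert_iff simp_thms)
qed

lemma reps_10_3_residues:
  assumes "j \<in> {2, 4}"
  shows "reps 10 3 (24 * int (5 * n + j) + 13) = {}"
proof -
  have "24 * int (5 * n + j) + 13 = 5 * (24 * int n + 12) + 1 \<or>
        24 * int (5 * n + j) + 13 = 5 * (24 * int n + 21) + 4"
    using assms by auto
  thus ?thesis by (elim disjE) (simp_all only: reps_10_3_empty insert_iff simp_thms)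
qed

theorem theorem1p5:
  fixes n :: nat
  shows "(\<forall>j\<in>{2, 4}. [b_coeff 3 5 8 (16 * (5 * n + j) + 3) = 0] (mod 2)) \<and>
         (\<forall>j\<in>{2, 4}. [b_coeff 3 5 8 (80 * (5 * n + j) + 51) = 0] (mod 2)) \<and>
         (\<forall>j\<in>{1, 3}. [b_coeff 3 5 8 (400 * (5 * n + j) + 291) = 0] (mod 2)) \<and>
         [b_coeff 3 5 8 (2000 * n + 1091) = b_coeff 3 5 8 (80 * n + 51)] (mod 2)"
proof (intro conjI ballI)
  fix j :: nat
  show "[b_coeff 3 5 8 (16 * (5 * n + j) + 3) = 0] (mod 2)" if "j \<in> {2, 4}"
  proof -
    \<comment> \<open>The index shift in \<open>even_b_coeff_iff_reps\<close> turns j = 2, 4 into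
      the residues 1, 3.\<close>
    define i where "i = j - 1"
    have i: "j = Suc i" "i \<in> {1, 3}" using that by (auto simp: i_def)
    hence "16 * (5 * n + j) + 3 = 16 * Suc (5 * n + i) + 3" by simp
    thus ?thesis
      by (simp only: cong_0_iff even_b_coeff_iff_reps reps_2_15_residues[OF i(2)] card.empty even_zero)
  qed
  show "[b_coeff 3 5 8 (80 * (5 * n + j) + 51) = 0] (mod 2)" if "j \<in> {2, 4}"
    by (simp only: cong_0_iff even_b_coeff_80 reps_10_3_residues[OF that] card.empty even_zero)
  show "[b_coeff 3 5 8 (400 * (5 * n + j) + 291) = 0] (mod 2)" if "j \<in> {1, 3}"
    by (simp only: cong_0_iff even_b_coeff_400 reps_2_15_residues[OF that] card.empty even_zero)
next
  \<comment> \<open>At index 5n + 2 the represented number has another factor 5; removing it leaves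
    24n + 13 and the form attached to 80n + 51.\<close>
  have "2000 * n + 1091 = 400 * (5 * n + 2) + 291" by simp
  moreover have "24 * int (5 * n + 2) + 17 = 5 * (24 * int n + 13)" by simp
  ultimately have "even (b_coeff 3 5 8 (2000 * n + 1091)) \<longleftrightarrow> even (b_coeff 3 5 8 (80 * n + 51))"
    by (simp only: even_b_coeff_400 even_b_coeff_80 card_reps_2_15)
  thus "[b_coeff 3 5 8 (2000 * n + 1091) = b_coeff 3 5 8 (80 * n + 51)] (mod 2)"
    by (simp add: cong_def mod_2_eq_odd)
qed

end
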